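(* Let $T>0$ and suppose that $w\in L^\infty(0,T;L^2(\mathbb{T}^3))\cap L^2(0,T;H^1(\mathbb{T}^3))$ is a weak solution of $$\partial_t w+(\mathbb{P}w\cdot\nabla)w+(\nabla\mathbb{P}w)^\top w-\Delta w=0$$ for initial data $w_0\in L^2(\mathbb{T}^3)$. Then $u:=\mathbb{P}w$ is a weak solution of the Navier--Stokes equations for initial data $u_0=\mathbb{P}w_0$.
   Context: Here $\mathbb{T}^3=\mathbb{R}^3/2\pi\mathbb{Z}^3$, all fields are $\mathbb{R}^3$-valued, and $\mathbb{P}$ is the Leray projection, i.e. the orthogonal projection of $L^2(\mathbb{T}^3)$ onto $L^2_\sigma$, the closed subspace of (weakly) divergence-free fields. Notation: $((\nabla v)^\top w)_i=\sum_j(\partial_i v_j)w_j$. Weak solution of the $w$-equation for initial data $w_0\in L^2$: a function $w\in L^\infty(0,T;L^2)\cap L^2(0,T;H^1)$ such that for all $\phi\in C_c^\infty([0,T)\times\mathbb{T}^3)$ (not necessarily divergence free) and all $t\in[0,T)$, $$(w(t),\phi(t))_{L^2}+\int_0^t((\mathbb{P}w\cdot\nabla)w+(\nabla\mathbb{P}w)^\top w,\phi)_{L^2}+(\nabla w,\nabla\phi)_{L^2}\,ds=(w_0,\phi(0))_{L^2}+\int_0^t(w,\partial_t\phi)_{L^2}\,ds.$$ Weak solution of Navier--Stokes (viscosity $1$) for initial data $u_0\in L^2$: a (weakly) divergence-free $u\in L^\infty(0,T;L^2)\cap L^2(0,T;H^1)$ such that for all $\psi\in C_c^\infty([0,T)\times\mathbb{T}^3)$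 with $\nabla\cdot\psi\equiv0$ and all $t\in[0,T)$, $$(u(t),\psi(t))_{L^2}+\int_0^t((u\cdot\nabla)u,\psi)_{L^2}+(\nabla u,\nabla\psi)_{L^2}\,ds=(u_0,\psi(0))_{L^2}+\int_0^t(u,\partial_t\psi)_{L^2}\,ds.$$ *)

theory Defs
  imports "HOL-Analysis.Analysis"
begin

text \<open>
  Fields on the torus \<open>\<real>\<^sup>3 / 2\<pi>\<int>\<^sup>3\<close> are represented by functions on \<open>\<real>\<^sup>3\<close> that are
  \<open>2\<pi>\<close>-periodic in every coordinate; integrals over the torus are Lebesgue integrals over the
  fundamental cell. Elements of the function spaces are representatives, and all norms, pairings and
  spaces below are insensitive to periodic changes on null sets.
\<close>

type_synonym R3 = "real ^ 3"

definition periodic :: "(R3 \<Rightarrow> 'b) \<Rightarrow> bool" where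
  "periodic f \<longleftrightarrow> (\<forall>x i. f (x + (2 * pi) *\<^sub>R axis i 1) = f x)"

definition torus :: "R3 measure" where
  "torus = lebesgue_on (cbox 0 (\<chi> i. 2 * pi))"


text \<open>
  Derivatives are taken within \<open>S\<close>, hence one-sided at boundary points. \<open>S\<close> will always be a convex
  set with nonempty interior, so that they are unique.
\<close>

fun Ck_on :: "nat \<Rightarrow> 'a::euclidean_space set \<Rightarrow> ('a \<Rightarrow> 'b::real_normed_vector) \<Rightarrow> bool" where
  "Ck_on 0 S f \<longleftrightarrow> continuous_on S f"
| "Ck_on (Suc k) S f \<longleftrightarrow>
     (\<exists>f'. (\<forall>x\<in>S. (f has_derivative f' x) (at x within S)) \<and> (\<forall>v. Ck_on k S (\<lambda>x. f' x v)))"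

definition smooth_on :: "'a::euclidean_space set \<Rightarrow> ('a \<Rightarrow> 'b::real_normed_vector) \<Rightarrow> bool" where
  "smooth_on S f \<longleftrightarrow> (\<forall>k. Ck_on k S f)"

definition smooth_torus :: "(R3 \<Rightarrow> 'b::real_normed_vector) \<Rightarrow> bool" where
  "smooth_torus f \<longleftrightarrow> periodic f \<and> smooth_on UNIV f"

definition partial :: "3 \<Rightarrow> (R3 \<Rightarrow> 'b::real_normed_vector) \<Rightarrow> R3 \<Rightarrow> 'b" where
  "partial i f x = frechet_derivative f (at x) (axis i 1)"

text \<open>Index convention: row \<open>i\<close> of a gradient is the \<open>i\<close>-th partial derivative, so for vector
  fields \<open>grad f x $ i $ j = \<partial>\<^sub>i f\<^sub>j\<close>.\<close>

definition grad :: "(R3 \<Rightarrow> 'b::real_normed_vector) \<Rightarrow> R3 \<Rightarrow> 'b ^ 3" where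
  "grad f x = (\<chi> i. partial i f x)"

definition divergence :: "(R3 \<Rightarrow> R3) \<Rightarrow> R3 \<Rightarrow> real" where
  "divergence f x = (\<Sum>i\<in>UNIV. partial i f x $ i)"


definition L2 :: "(R3 \<Rightarrow> 'b::euclidean_space) set" where
  "L2 = {f. periodic f \<and> f \<in> borel_measurable torus \<and> integrable torus (\<lambda>x. (norm (f x))\<^sup>2)}"

definition l2_inner :: "(R3 \<Rightarrow> 'b::euclidean_space) \<Rightarrow> (R3 \<Rightarrow> 'b) \<Rightarrow> real" where
  "l2_inner f g = (LINT x|torus. f x \<bullet> g x)"

definition l2_norm :: "(R3 \<Rightarrow> 'b::euclidean_space) \<Rightarrow> real" where
  "l2_norm f = sqrt (l2_inner f f)"

definition has_weak_grad :: "(R3 \<Rightarrow> R3) \<Rightarrow> (R3 \<Rightarrow> R3 ^ 3) \<Rightarrow> bool" where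
  "has_weak_grad f G \<longleftrightarrow>
     (\<forall>\<theta> :: R3 \<Rightarrow> real. smooth_torus \<theta> \<longrightarrow>
        (\<forall>i. (LINT x|torus. partial i \<theta> x *\<^sub>R f x) = - (LINT x|torus. \<theta> x *\<^sub>R (G x $ i))))"

definition H1 :: "(R3 \<Rightarrow> R3) set" where
  "H1 = {f \<in> L2. \<exists>G\<in>L2. has_weak_grad f G}"

definition weak_grad :: "(R3 \<Rightarrow> R3) \<Rightarrow> R3 \<Rightarrow> R3 ^ 3" where
  "weak_grad f = (SOME G. G \<in> L2 \<and> has_weak_grad f G)"

definition h1_norm :: "(R3 \<Rightarrow> R3) \<Rightarrow> real" where
  "h1_norm f = sqrt ((l2_norm f)\<^sup>2 + (l2_norm (weak_grad f))\<^sup>2)"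

definition L2_sigma :: "(R3 \<Rightarrow> R3) set" where
  "L2_sigma = {v \<in> L2. \<forall>\<theta> :: R3 \<Rightarrow> real. smooth_torus \<theta> \<longrightarrow> l2_inner v (grad \<theta>) = 0}"

text \<open>A representative of the orthogonal projection, which is unique almost everywhere.\<close>

definition leray :: "(R3 \<Rightarrow> R3) \<Rightarrow> R3 \<Rightarrow> R3" where
  "leray f = (SOME g. g \<in> L2_sigma \<and> (\<forall>z\<in>L2_sigma. l2_inner (\<lambda>x. f x - g x) z = 0))"


text \<open>
  Bochner measurability on \<open>(0,T)\<close> with values in the space \<open>X\<close> normed by \<open>N\<close>: almost everywhere
  limit, in the norm \<open>N\<close>, of \<open>X\<close>-valued simple functions.
\<close>

definition strongly_measurable ::
    "real \<Rightarrow> (R3 \<Rightarrow> R3) set \<Rightarrow> ((R3 \<Rightarrow> R3) \<Rightarrow> real) \<Rightarrow> (real \<Rightarrow> R3 \<Rightarrow> R3) \<Rightarrow> bool" where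
  "strongly_measurable T X N w \<longleftrightarrow>
     (AE t in lebesgue_on {0<..<T}. w t \<in> X) \<and>
     (\<exists>s :: nat \<Rightarrow> real \<Rightarrow> R3 \<Rightarrow> R3.
        (\<forall>n. simple_function (lebesgue_on {0<..<T}) (s n) \<and> s n ` {0<..<T} \<subseteq> X) \<and>
        (AE t in lebesgue_on {0<..<T}. (\<lambda>n. N (\<lambda>x. s n t x - w t x)) \<longlonglongrightarrow> 0))"

definition Linf_L2 :: "real \<Rightarrow> (real \<Rightarrow> R3 \<Rightarrow> R3) set" where
  "Linf_L2 T = {w. strongly_measurable T L2 l2_norm w \<and>
                   (\<exists>C. AE t in lebesgue_on {0<..<T}. l2_norm (w t) \<le> C)}"

definition L2_H1 :: "real \<Rightarrow> (real \<Rightarrow> R3 \<Rightarrow> R3) set" where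
  "L2_H1 T = {w. strongly_measurable T H1 h1_norm w \<and>
                 integrable (lebesgue_on {0<..<T}) (\<lambda>t. (h1_norm (w t))\<^sup>2)}"


text \<open>
  \<open>C\<^sub>c\<^sup>\<infinity>([0,T) \<times> \<bbbT>\<^sup>3)\<close>: since the torus is compact, compact support means vanishing for times
  close to \<open>T\<close>; nothing is required to vanish at time \<open>0\<close>.
\<close>

definition test_field :: "real \<Rightarrow> (real \<Rightarrow> R3 \<Rightarrow> R3) \<Rightarrow> bool" where
  "test_field T \<phi> \<longleftrightarrow>
     (\<forall>t\<in>{0..<T}. periodic (\<phi> t)) \<and>
     smooth_on ({0..<T} \<times> UNIV) (\<lambda>(t, x). \<phi> t x) \<and>
     (\<exists>T'<T. \<forall>t\<in>{0..<T}. T' \<le> t \<longrightarrow> (\<forall>x. \<phi> t x = 0))"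

definition time_deriv :: "real \<Rightarrow> (real \<Rightarrow> R3 \<Rightarrow> R3) \<Rightarrow> real \<Rightarrow> R3 \<Rightarrow> R3" where
  "time_deriv T \<phi> t x = vector_derivative (\<lambda>r. \<phi> r x) (at t within {0..<T})"

text \<open>\<open>convect v w = (v \<cdot> \<nabla>) w\<close> and \<open>grad_transp v w = (\<nabla> v)\<^sup>T w\<close>, where the latter has
  components \<open>\<Sum>\<^sub>j (\<partial>\<^sub>i v\<^sub>j) w\<^sub>j\<close>.\<close>

definition convect :: "(R3 \<Rightarrow> R3) \<Rightarrow> (R3 \<Rightarrow> R3) \<Rightarrow> R3 \<Rightarrow> R3" where
  "convect v w x = (\<Sum>j\<in>UNIV. (v x $ j) *\<^sub>R (weak_grad w x $ j))"

definition grad_transp :: "(R3 \<Rightarrow> R3) \<Rightarrow> (R3 \<Rightarrow> R3) \<Rightarrow> R3 \<Rightarrow> R3" where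
  "grad_transp v w x = (\<chi> i. \<Sum>j\<in>UNIV. (weak_grad v x $ i $ j) * (w x $ j))"

text \<open>
  The weak formulations evaluate the solution at every \<open>t \<in> [0,T)\<close>, so a solution is a function
  with a value in \<open>L\<^sup>2\<close> at each such time, not merely at almost every one.
\<close>

definition weak_solution_w ::
    "real \<Rightarrow> (R3 \<Rightarrow> R3) \<Rightarrow> (real \<Rightarrow> R3 \<Rightarrow> R3) \<Rightarrow> bool" where
  "weak_solution_w T w0 w \<longleftrightarrow>
     w0 \<in> L2 \<and> (\<forall>t\<in>{0..<T}. w t \<in> L2) \<and> w \<in> Linf_L2 T \<inter> L2_H1 T \<and>
     (\<forall>\<phi>. test_field T \<phi> \<longrightarrow> (\<forall>t\<in>{0..<T}.
        l2_inner (w t) (\<phi> t)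
          + (LINT s:{0..t}|lebesgue.
               l2_inner (\<lambda>x. convect (leray (w s)) (w s) x + grad_transp (leray (w s)) (w s) x) (\<phi> s)
               + l2_inner (weak_grad (w s)) (grad (\<phi> s)))
        = l2_inner w0 (\<phi> 0)
          + (LINT s:{0..t}|lebesgue. l2_inner (w s) (time_deriv T \<phi> s))))"

definition weak_solution_NS ::
    "real \<Rightarrow> (R3 \<Rightarrow> R3) \<Rightarrow> (real \<Rightarrow> R3 \<Rightarrow> R3) \<Rightarrow> bool" where
  "weak_solution_NS T u0 u \<longleftrightarrow>
     u0 \<in> L2 \<and> (\<forall>t\<in>{0..<T}. u t \<in> L2_sigma) \<and> u \<in> Linf_L2 T \<inter> L2_H1 T \<and>
     (\<forall>\<psi>. test_field T \<psi> \<and> (\<forall>t\<in>{0..<T}. \<forall>x. divergence (\<psi> t) x = 0) \<longrightarrow> (\<forall>t\<in>{0..<T}.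
        l2_inner (u t) (\<psi> t)
          + (LINT s:{0..t}|lebesgue.
               l2_inner (convect (u s) (u s)) (\<psi> s)
               + l2_inner (weak_grad (u s)) (grad (\<psi> s)))
        = l2_inner u0 (\<psi> 0)
          + (LINT s:{0..t}|lebesgue. l2_inner (u s) (time_deriv T \<psi> s))))"

end

theory Submission
  imports Defs
begin

text \<open>
  Put \<open>u = \<P>w\<close> and \<open>r = w - u\<close>. Testing with divergence-free \<open>\<psi>\<close>, the pairings of \<open>w\<close> with \<open>\<psi>\<close>
  and \<open>\<partial>\<^sub>t\<psi>\<close> only see \<open>u\<close>, and \<open>\<P>\<close> commutes with weak derivatives. Since \<open>r\<close> is orthogonal to the
  divergence-free fields, \<open>\<nabla>r\<close> is symmetric, so that
  \<open>(u \<cdot> \<nabla>)w + (\<nabla>u)\<^sup>T w - (u \<cdot> \<nabla>)u = \<nabla>(u \<cdot> r + \<bar>u\<bar>\<^sup>2 / 2)\<close>, which is orthogonal to \<open>\<psi>\<close>.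

  The facts on weak derivatives all state that a continuous linear functional of
  \<open>(v, \<nabla>v)\<close> vanishes on \<open>H\<^sup>1\<close>; by completeness of the trigonometric system in \<open>L\<^sup>2\<close> it suffices to test them on fields
  \<open>cos (k \<cdot> x + c) e\<close>, for which \<open>\<P>\<close> and the derivatives are explicit.
\<close>

section \<open>Square integrable fields and orthogonal projections\<close>

text \<open>The obstacle is regularity. For u and r in H^1 the product u . r has in general only an
  integrable gradient, so it cannot be treated as an H^1 function. Instead the integral of \<psi> .
  \<nabla>(u . v) is read, for fixed u, as a functional of v alone. Its coefficients are products of
  derivatives of order at most one of u with the smooth \<psi>, hence square integrable, so only the
  factor v has to be replaced by waves. A second difficulty is choice: \<open>leray\<close> and
  \<open>weak_grad\<close> select representatives. Linearity and idempotence of the projection and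
  its commutation with derivatives therefore hold only almost everywhere, and each is derived from a
  uniqueness statement. Time causes two more. The integrands in s come with no measurability
  information, so they are exchanged through almost everywhere equality for the complete Lebesgue
  measure.\<close>

lemma finite_measure_torus: "finite_measure torus"
  unfolding torus_def by (rule finite_measure_lebesgue_on) simp

interpretation torus: finite_measure torus
  by (rule finite_measure_torus)

lemma space_torus [simp]: "space torus = cbox 0 (\<chi> i. 2 * pi)"
  by (simp add: torus_def)

lemma L2_I:
  "periodic f \<Longrightarrow> f \<in> borel_measurable torus \<Longrightarrow> integrable torus (\<lambda>x. (norm (f x))\<^sup>2) \<Longrightarrow> f \<in> L2"
  by (simp add: L2_def)

lemma L2_measurable: "f \<in> L2 \<Longrightarrow> f \<in> borel_measurable torus"
  and L2_periodic: "f \<in> L2 \<Longrightarrow> periodic f"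
  and L2_square: "f \<in> L2 \<Longrightarrow> integrable torus (\<lambda>x. (norm (f x))\<^sup>2)"
  by (auto simp: L2_def)

lemma integrable_inner_L2:
  assumes "f \<in> L2" "g \<in> L2"
  shows "integrable torus (\<lambda>x. f x \<bullet> g x)"
proof (rule Bochner_Integration.integrable_bound)
  show "integrable torus (\<lambda>x. (norm (f x))\<^sup>2 + (norm (g x))\<^sup>2)"
    using assms by (intro Bochner_Integration.integrable_add L2_square)
  show "(\<lambda>x. f x \<bullet> g x) \<in> borel_measurable torus"
    using assms by (intro borel_measurable_inner L2_measurable)
  have "\<bar>f x \<bullet> g x\<bar> \<le> (norm (f x))\<^sup>2 + (norm (g x))\<^sup>2" for x
  proof -
    have "\<bar>f x \<bullet> g x\<bar> \<le> norm (f x) * norm (g x)" by (rule Cauchy_Schwarz_ineq2)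
    also have "\<dots> \<le> (norm (f x))\<^sup>2 + (norm (g x))\<^sup>2"
      using sum_squares_bound[of "norm (f x)" "norm (g x)"] mult_nonneg_nonneg[OF norm_ge_zero norm_ge_zero, of "f x" "g x"]
      by linarith
    finally show ?thesis .
  qed
  then show "AE x in torus. norm (f x \<bullet> g x) \<le> norm ((norm (f x))\<^sup>2 + (norm (g x))\<^sup>2)"
    by simp
qed

lemma periodic_comp: "periodic f \<Longrightarrow> periodic (\<lambda>x. h (f x))"
  and periodic_comp2: "periodic f \<Longrightarrow> periodic g \<Longrightarrow> periodic (\<lambda>x. h2 (f x) (g x))"
  by (simp_all add: periodic_def)

lemma L2_comp_bound:
  fixes f :: "R3 \<Rightarrow> 'b::euclidean_space" and g :: "R3 \<Rightarrow> 'c::euclidean_space"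
  assumes "f \<in> L2" "periodic g" "g \<in> borel_measurable torus"
    and "\<And>x. x \<in> cbox 0 (\<chi> i. 2 * pi) \<Longrightarrow> norm (g x) \<le> c * norm (f x)"
  shows "g \<in> L2"
proof (rule L2_I[OF assms(2,3)])
  show "integrable torus (\<lambda>x. (norm (g x))\<^sup>2)"
  proof (rule Bochner_Integration.integrable_bound)
    show "integrable torus (\<lambda>x. c\<^sup>2 * (norm (f x))\<^sup>2)"
      using L2_square[OF assms(1)] by simp
    have "(norm (g x))\<^sup>2 \<le> c\<^sup>2 * (norm (f x))\<^sup>2" if "x \<in> space torus" for x
      using power_mono[OF assms(4)[OF that[simplified]], of 2] by (simp add: power_mult_distrib)
    then show "AE x in torus. norm ((norm (g x))\<^sup>2) \<le> norm (c\<^sup>2 * (norm (f x))\<^sup>2)"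
      by (intro AE_I2) simp
  qed (use assms(3) in measurable)
qed

lemma L2_bounded_linear:
  assumes "f \<in> L2" "bounded_linear h"
  shows "(\<lambda>x. h (f x)) \<in> L2"
proof -
  obtain K where K: "\<And>y. norm (h y) \<le> norm y * K"
    using bounded_linear.bounded[OF assms(2)] by blast
  have "h \<in> borel_measurable borel"
    by (intro borel_measurable_continuous_onI linear_continuous_on assms(2))
  then show ?thesis
    by (intro L2_comp_bound[OF assms(1), where c = K])
       (use assms K L2_measurable L2_periodic in
         \<open>auto intro: periodic_comp measurable_compose[of f] simp: mult.commute\<close>)
qed

lemma L2_scaleR: "f \<in> L2 \<Longrightarrow> (\<lambda>x. c *\<^sub>R f x) \<in> L2"
  by (rule L2_bounded_linear[OF _ bounded_linear_scaleR_right])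

lemma L2_add:
  assumes "f \<in> L2" "g \<in> L2"
  shows "(\<lambda>x. f x + g x) \<in> L2"
proof (rule L2_I)
  show "integrable torus (\<lambda>x. (norm (f x + g x))\<^sup>2)"
    unfolding power2_norm_eq_inner inner_add_left inner_add_right
    using assms by (intro Bochner_Integration.integrable_add integrable_inner_L2)
qed (use assms in \<open>auto intro: borel_measurable_add L2_measurable L2_periodic periodic_comp2\<close>)

lemma L2_diff:
  assumes "f \<in> L2" "g \<in> L2"
  shows "(\<lambda>x. f x - g x) \<in> L2"
  using L2_add[OF assms(1) L2_scaleR[OF assms(2), of "-1"]] by simp

lemma L2_norm:
  assumes "f \<in> L2"
  shows "(\<lambda>x. norm (f x)) \<in> L2"
proof (rule L2_I)
  show "(\<lambda>x. norm (f x)) \<in> borel_measurable torus"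
    by (rule measurable_compose[OF L2_measurable[OF assms] borel_measurable_norm])
qed (use L2_square[OF assms] L2_periodic[OF assms] in \<open>simp_all add: periodic_def\<close>)

lemma L2_const: "(\<lambda>x. c) \<in> L2"
  by (rule L2_I) (auto simp: periodic_def)

lemma L2_sum: "(\<And>i. i \<in> I \<Longrightarrow> f i \<in> L2) \<Longrightarrow> (\<lambda>x. \<Sum>i\<in>I. f i x) \<in> L2"
  by (induction I rule: infinite_finite_induct) (auto intro: L2_const L2_add)

lemma L2_nth: "f \<in> L2 \<Longrightarrow> (\<lambda>x. f x $ i) \<in> L2"
  by (rule L2_bounded_linear[OF _ bounded_linear_vec_nth])

lemma L2_vec:
  fixes f :: "'n::finite \<Rightarrow> R3 \<Rightarrow> 'b::euclidean_space"
  assumes "\<And>i. f i \<in> L2"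
  shows "(\<lambda>x. \<chi> i. f i x) \<in> L2"
proof -
  have lin: "bounded_linear (axis i :: 'b \<Rightarrow> 'b ^ 'n)" for i
    unfolding linear_conv_bounded_linear[symmetric]
    by (rule linearI) (simp_all add: axis_def vec_eq_iff)
  have "(\<lambda>x. \<chi> i. f i x) = (\<lambda>x. \<Sum>i\<in>UNIV. axis i (f i x))"
    by (simp add: fun_eq_iff vec_eq_iff axis_def)
  then show ?thesis
    by (simp only:) (intro L2_sum L2_bounded_linear[OF _ lin] assms)
qed

lemma L2_Pair:
  fixes f :: "R3 \<Rightarrow> 'b::euclidean_space" and g :: "R3 \<Rightarrow> 'c::euclidean_space"
  assumes "f \<in> L2" "g \<in> L2"
  shows "(\<lambda>x. (f x, g x)) \<in> L2"
proof -
  have "(\<lambda>x. (f x, 0 :: 'c)) \<in> L2"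
    by (rule L2_bounded_linear[OF assms(1), where h = "\<lambda>y. (y, 0)"])
       (intro bounded_linear_Pair bounded_linear_ident bounded_linear_zero)
  moreover have "(\<lambda>x. (0 :: 'b, g x)) \<in> L2"
    by (rule L2_bounded_linear[OF assms(2), where h = "\<lambda>y. (0, y)"])
       (intro bounded_linear_Pair bounded_linear_ident bounded_linear_zero)
  ultimately show ?thesis
    using L2_add[of "\<lambda>x. (f x, 0)" "\<lambda>x. (0, g x)"] by simp
qed

lemma l2_inner_commute: "l2_inner f g = l2_inner g f"
  by (simp add: l2_inner_def inner_commute)

lemma l2_inner_scaleR:
  "l2_inner (\<lambda>x. c *\<^sub>R f x) g = c * l2_inner f g"
  "l2_inner f (\<lambda>x. c *\<^sub>R g x) = c * l2_inner f g"
  by (simp_all add: l2_inner_def)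

lemma l2_inner_add_left:
  "f \<in> L2 \<Longrightarrow> g \<in> L2 \<Longrightarrow> h \<in> L2 \<Longrightarrow> l2_inner (\<lambda>x. f x + g x) h = l2_inner f h + l2_inner g h"
  by (simp add: l2_inner_def inner_add_left integrable_inner_L2)

lemma l2_inner_add_right:
  "f \<in> L2 \<Longrightarrow> g \<in> L2 \<Longrightarrow> h \<in> L2 \<Longrightarrow> l2_inner h (\<lambda>x. f x + g x) = l2_inner h f + l2_inner h g"
  by (simp add: l2_inner_def inner_add_right integrable_inner_L2)

lemma l2_inner_diff_left:
  "f \<in> L2 \<Longrightarrow> g \<in> L2 \<Longrightarrow> h \<in> L2 \<Longrightarrow> l2_inner (\<lambda>x. f x - g x) h = l2_inner f h - l2_inner g h"
  by (simp add: l2_inner_def inner_diff_left integrable_inner_L2)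

lemma l2_inner_diff_right:
  "f \<in> L2 \<Longrightarrow> g \<in> L2 \<Longrightarrow> h \<in> L2 \<Longrightarrow> l2_inner h (\<lambda>x. f x - g x) = l2_inner h f - l2_inner h g"
  by (simp add: l2_inner_def inner_diff_right integrable_inner_L2)

lemma l2_inner_sum_right:
  "(\<And>i. i \<in> I \<Longrightarrow> f i \<in> L2) \<Longrightarrow> h \<in> L2 \<Longrightarrow>
    l2_inner h (\<lambda>x. \<Sum>i\<in>I. f i x) = (\<Sum>i\<in>I. l2_inner h (f i))"
  by (simp add: l2_inner_def inner_sum_right integrable_inner_L2)

lemma l2_inner_vec:
  fixes f g :: "R3 \<Rightarrow> 'b::euclidean_space ^ 'n::finite"
  assumes "f \<in> L2" "g \<in> L2"
  shows "l2_inner f g = (\<Sum>i\<in>UNIV. l2_inner (\<lambda>x. f x $ i) (\<lambda>x. g x $ i))"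
  using assms by (simp add: l2_inner_def inner_vec_def integrable_inner_L2 L2_nth)

lemma l2_inner_Pair:
  assumes "f \<in> L2" "g \<in> L2" "f' \<in> L2" "g' \<in> L2"
  shows "l2_inner (\<lambda>x. (f x, g x)) (\<lambda>x. (f' x, g' x)) = l2_inner f f' + l2_inner g g'"
  using assms by (simp add: l2_inner_def integrable_inner_L2)

lemma l2_inner_cong_AE:
  assumes "AE x in torus. f x = f' x" "AE x in torus. g x = g' x" "f \<in> L2" "f' \<in> L2" "g \<in> L2" "g' \<in> L2"
  shows "l2_inner f g = l2_inner f' g'"
  unfolding l2_inner_def
proof (rule integral_cong_AE)
  show "AE x in torus. f x \<bullet> g x = f' x \<bullet> g' x"
    using assms(1,2) by eventually_elim simp
qed (use assms in \<open>auto intro: borel_measurable_integrable integrable_inner_L2\<close>)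

lemma l2_inner_self_nonneg: "0 \<le> l2_inner f f"
  by (simp add: l2_inner_def)

lemma l2_norm_nonneg: "0 \<le> l2_norm f"
  by (simp add: l2_norm_def l2_inner_self_nonneg)

lemma l2_norm_square: "(l2_norm f)\<^sup>2 = l2_inner f f"
  by (simp add: l2_norm_def l2_inner_self_nonneg)

lemma l2_norm_minus_commute: "l2_norm (\<lambda>x. f x - g x) = l2_norm (\<lambda>x. g x - f x)"
  by (simp add: l2_norm_def l2_inner_def inner_diff_left inner_diff_right inner_commute algebra_simps)

text \<open>Serves twice: it gives the Cauchy-Schwarz inequality, and, with \<open>a = 0\<close>, it
  forces the linear coefficient \<open>b\<close> to vanish at the minimiser in
  \<open>projection_exists\<close>.\<close>

lemma nonneg_quadratic_discriminant:
  fixes a b c :: real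
  assumes nonneg: "\<And>t. 0 \<le> a + 2 * t * b + t\<^sup>2 * c" and "c \<ge> 0"
  shows "b\<^sup>2 \<le> a * c"
proof (cases "c = 0")
  case True
  have "b = 0"
  proof (rule ccontr)
    assume "b \<noteq> 0"
    \<comment> \<open>Without a quadratic term the form is affine in t; this t is the point where it
      takes the value -1.\<close>
    then have "2 * (- (a + 1) / (2 * b)) * b = - (a + 1)" by simp
    then show False
      using nonneg[of "- (a + 1) / (2 * b)"] True by simp
  qed
  with True show ?thesis by simp
next
  case False
  with \<open>c \<ge> 0\<close> have "c > 0" by simp
  have "2 * (- b / c) * b + (- b / c)\<^sup>2 * c = - (b\<^sup>2 / c)"
    using \<open>c > 0\<close> by (simp add: power2_eq_square)
  then have "b\<^sup>2 / c \<le> a"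
    using nonneg[of "- b / c"] by linarith
  then show ?thesis
    using \<open>c > 0\<close> by (simp add: pos_divide_le_eq)
qed

lemma l2_Cauchy_Schwarz:
  assumes "f \<in> L2" "g \<in> L2"
  shows "\<bar>l2_inner f g\<bar> \<le> l2_norm f * l2_norm g"
proof -
  have "0 \<le> l2_inner f f + 2 * t * l2_inner f g + t\<^sup>2 * l2_inner g g" for t
  proof -
    have "0 \<le> l2_inner (\<lambda>x. f x + t *\<^sub>R g x) (\<lambda>x. f x + t *\<^sub>R g x)"
      by (rule l2_inner_self_nonneg)
    also have "\<dots> = l2_inner f f + 2 * t * l2_inner f g + t\<^sup>2 * l2_inner g g"
      using assms by (simp add: l2_inner_add_left l2_inner_add_right L2_add L2_scaleR l2_inner_scaleR
          l2_inner_commute[of g f] power2_eq_square algebra_simps)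
    finally show ?thesis .
  qed
  then have "\<bar>l2_inner f g\<bar>\<^sup>2 \<le> (l2_norm f * l2_norm g)\<^sup>2"
    by (simp add: power_mult_distrib l2_norm_square nonneg_quadratic_discriminant l2_inner_self_nonneg)
  then show ?thesis
    by (rule power2_le_imp_le) (simp add: l2_norm_nonneg)
qed

lemma l2_norm_triangle:
  assumes "f \<in> L2" "g \<in> L2"
  shows "l2_norm (\<lambda>x. f x + g x) \<le> l2_norm f + l2_norm g"
proof -
  have "(l2_norm (\<lambda>x. f x + g x))\<^sup>2 = l2_inner f f + 2 * l2_inner f g + l2_inner g g"
    using assms by (simp add: l2_norm_square l2_inner_add_left l2_inner_add_right L2_add
          l2_inner_commute[of g f])
  also have "\<dots> \<le> (l2_norm f + l2_norm g)\<^sup>2"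
    using l2_Cauchy_Schwarz[OF assms] by (simp add: power2_sum l2_norm_square)
  finally show ?thesis
    by (rule power2_le_imp_le) (simp add: l2_norm_nonneg)
qed

lemma l2_norm_reverse_triangle:
  assumes "f \<in> L2" "g \<in> L2"
  shows "\<bar>l2_norm f - l2_norm g\<bar> \<le> l2_norm (\<lambda>x. f x - g x)"
  using l2_norm_triangle[OF L2_diff[OF assms] assms(2)]
    l2_norm_triangle[OF L2_diff[OF assms(2,1)] assms(1)]
  by (simp add: l2_norm_minus_commute[of g f])

lemma l2_inner_self_eq_0:
  assumes "f \<in> L2" "l2_inner f f = 0"
  shows "AE x in torus. f x = 0"
  using integral_nonneg_eq_0_iff_AE[OF integrable_inner_L2[OF assms(1,1)]] assms(2)
  by (simp add: l2_inner_def)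

lemma tendsto_l2_inner:
  assumes "\<And>n. v n \<in> L2" "v' \<in> L2" "h \<in> L2" "(\<lambda>n. l2_norm (\<lambda>x. v n x - v' x)) \<longlonglongrightarrow> 0"
  shows "(\<lambda>n. l2_inner (v n) h) \<longlonglongrightarrow> l2_inner v' h"
proof -
  have "\<bar>l2_inner (v n) h - l2_inner v' h\<bar> \<le> l2_norm (\<lambda>x. v n x - v' x) * l2_norm h" for n
    using l2_Cauchy_Schwarz[OF L2_diff[OF assms(1)[of n] assms(2)] assms(3)] assms(1-3)
    by (simp add: l2_inner_diff_left)
  moreover have "(\<lambda>n. l2_norm (\<lambda>x. v n x - v' x) * l2_norm h) \<longlonglongrightarrow> 0"
    by (rule tendsto_mult_left_zero[OF assms(4)])
  ultimately have "(\<lambda>n. l2_inner (v n) h - l2_inner v' h) \<longlonglongrightarrow> 0"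
    by (intro Lim_null_comparison[of "\<lambda>n. l2_inner (v n) h - l2_inner v' h"]) (auto intro: always_eventually)
  then show ?thesis
    by (simp add: LIM_zero_iff)
qed

section \<open>Completeness of L^2 and orthogonal projections\<close>

lemma nn_integral_square_L2:
  assumes "f \<in> L2"
  shows "(\<integral>\<^sup>+x. ennreal ((norm (f x))\<^sup>2) \<partial>torus) = ennreal ((l2_norm f)\<^sup>2)"
  using nn_integral_eq_integral[OF L2_square[OF assms]]
  by (simp add: l2_norm_square l2_inner_def dot_square_norm)

lemma Riesz_Fischer:
  fixes v :: "nat \<Rightarrow> R3 \<Rightarrow> 'b::euclidean_space"
  assumes v: "\<And>n. v n \<in> L2" and step: "\<And>n. l2_norm (\<lambda>x. v (Suc n) x - v n x) \<le> C * (1 / 2) ^ n"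
  shows "\<exists>v'\<in>L2. (\<lambda>n. l2_norm (\<lambda>x. v n x - v' x)) \<longlonglongrightarrow> 0"
proof -
  have C: "C \<ge> 0" using step[of 0] l2_norm_nonneg[of "\<lambda>x. v (Suc 0) x - v 0 x"] by simp
  have far: "l2_norm (\<lambda>x. v (m + k) x - v m x) \<le> 2 * C * (1 / 2) ^ m" for m k
  proof -
    have "l2_norm (\<lambda>x. v (m + k) x - v m x) \<le> (\<Sum>j<k. C * (1 / 2) ^ (m + j))"
    proof (induction k)
      case 0
      show ?case by (simp add: l2_norm_def l2_inner_def)
    next
      case (Suc k)
      have "(\<lambda>x. v (m + Suc k) x - v m x) =
          (\<lambda>x. (v (Suc (m + k)) x - v (m + k) x) + (v (m + k) x - v m x))" by simp
      then show ?case
        using l2_norm_triangle[OF L2_diff[OF v[of "Suc (m + k)"] v[of "m + k"]] L2_diff[OF v[of "m + k"] v[of m]]]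
          step[of "m + k"] Suc by simp
    qed
    also have "\<dots> = C * (1 / 2) ^ m * (\<Sum>j<k. (1 / 2) ^ j)"
      by (simp add: sum_distrib_left power_add mult_ac)
    also have "\<dots> \<le> C * (1 / 2) ^ m * 2"
    proof (intro mult_left_mono)
      show "(\<Sum>j<k. (1 / 2) ^ j) \<le> (2::real)"
        by (simp add: sum_gp_strict)
    qed (use C in auto)
    finally show ?thesis by (simp add: mult_ac)
  qed
  define h where "h n x = norm (v (Suc n) x - v n x)" for n x
  have hL2: "h n \<in> L2" for n
    unfolding h_def
    by (intro L2_norm L2_diff v)
  have one: "(\<lambda>x. 1::real) \<in> L2" by (rule L2_const)
  have int: "integrable torus (h n)" for n
    using integrable_inner_L2[OF hL2[of n] one] by simp
  have hint: "(LINT x|torus. h n x) \<le> C * l2_norm (\<lambda>x. 1::real) * (1 / 2) ^ n" for n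
  proof -
    have "(LINT x|torus. h n x) = l2_inner (h n) (\<lambda>x. 1)"
      by (simp add: l2_inner_def)
    also have "\<dots> \<le> l2_norm (h n) * l2_norm (\<lambda>x. 1::real)"
      using l2_Cauchy_Schwarz[OF hL2[of n] one] by simp
    also have "l2_norm (h n) = l2_norm (\<lambda>x. v (Suc n) x - v n x)"
      by (simp add: l2_norm_def l2_inner_def h_def dot_square_norm power2_eq_square)
    also have "\<dots> * l2_norm (\<lambda>x. 1::real) \<le> (C * (1 / 2) ^ n) * l2_norm (\<lambda>x. 1::real)"
      by (intro mult_right_mono step l2_norm_nonneg)
    finally show ?thesis by (simp add: mult_ac)
  qed
  have "(\<integral>\<^sup>+x. (\<Sum>n. ennreal (h n x)) \<partial>torus) = (\<Sum>n. \<integral>\<^sup>+x. ennreal (h n x) \<partial>torus)"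
    using int by (intro nn_integral_suminf) auto
  also have "\<dots> = (\<Sum>n. ennreal (LINT x|torus. h n x))"
    using int by (subst nn_integral_eq_integral) (auto simp: h_def)
  also have "\<dots> \<le> (\<Sum>n. ennreal (C * l2_norm (\<lambda>x. 1::real) * (1 / 2) ^ n))"
    by (intro suminf_le ennreal_leI hint) auto
  also have "\<dots> = ennreal (\<Sum>n. C * l2_norm (\<lambda>x. 1::real) * (1 / 2) ^ n)"
    using C by (intro suminf_ennreal2 summable_mult summable_geometric) (auto simp: l2_norm_nonneg)
  finally have "(\<integral>\<^sup>+x. (\<Sum>n. ennreal (h n x)) \<partial>torus) \<noteq> \<infinity>"
    using neq_top_trans[OF ennreal_neq_top] by auto
  then have "AE x in torus. (\<Sum>n. ennreal (h n x)) \<noteq> \<infinity>"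
    using int by (intro nn_integral_PInf_AE) auto
  then have AEconv: "AE x in torus. convergent (\<lambda>n. v n x)"
  proof eventually_elim
    case (elim x)
    then have "summable (\<lambda>n. h n x)"
      by (intro summable_suminf_not_top) (auto simp: h_def)
    then have "summable (\<lambda>n. v (Suc n) x - v n x)"
      unfolding h_def by (rule summable_norm_cancel)
    then have "convergent (\<lambda>n. \<Sum>k<n. v (Suc k) x - v k x)"
      by (simp add: summable_iff_convergent)
    then have "convergent (\<lambda>n. v n x - v 0 x)"
      by (simp only: sum_lessThan_telescope[of "\<lambda>n. v n x"])
    then show ?case by (simp add: convergent_diff_const_right_iff)
  qed
  \<comment> \<open>Where the sequence diverges, \<open>lim\<close> is some unspecified value, but
    one that depends on the sequence alone; so v' inherits exact periodicity from the
    \<open>v n\<close>.\<close>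
  define v' where "v' x = lim (\<lambda>n. v n x)" for x
  have meas: "v' \<in> borel_measurable torus"
    unfolding v'_def[abs_def] by (intro borel_measurable_lim_metric L2_measurable v)
  have per: "periodic v'"
    using v[THEN L2_periodic] by (simp add: v'_def periodic_def)
  have fatou: "(\<integral>\<^sup>+x. ennreal ((norm (v m x - v' x))\<^sup>2) \<partial>torus) \<le> ennreal ((2 * C * (1 / 2) ^ m)\<^sup>2)" for m
  proof -
    have "(\<integral>\<^sup>+x. ennreal ((norm (v m x - v' x))\<^sup>2) \<partial>torus)
        = (\<integral>\<^sup>+x. liminf (\<lambda>n. ennreal ((norm (v m x - v n x))\<^sup>2)) \<partial>torus)"
    proof (rule nn_integral_cong_AE)
      show "AE x in torus. ennreal ((norm (v m x - v' x))\<^sup>2) = liminf (\<lambda>n. ennreal ((norm (v m x - v n x))\<^sup>2))"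
        using AEconv
      proof eventually_elim
        case (elim x)
        then have "(\<lambda>n. v n x) \<longlonglongrightarrow> v' x" by (simp add: v'_def convergent_LIMSEQ_iff)
        then have "(\<lambda>n. ennreal ((norm (v m x - v n x))\<^sup>2)) \<longlonglongrightarrow> ennreal ((norm (v m x - v' x))\<^sup>2)"
          by (intro tendsto_intros)
        then show ?case by (intro lim_imp_Liminf[symmetric]) simp
      qed
    qed
    also have "\<dots> \<le> liminf (\<lambda>n. \<integral>\<^sup>+x. ennreal ((norm (v m x - v n x))\<^sup>2) \<partial>torus)"
      by (intro nn_integral_liminf) (use v L2_measurable in measurable)
    also have "\<dots> \<le> ennreal ((2 * C * (1 / 2) ^ m)\<^sup>2)"
    proof (rule order_trans[OF Liminf_le_Limsup Limsup_bounded], simp, rule eventually_sequentiallyI)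
      show "(\<integral>\<^sup>+x. ennreal ((norm (v m x - v n x))\<^sup>2) \<partial>torus) \<le> ennreal ((2 * C * (1 / 2) ^ m)\<^sup>2)"
        if "n \<ge> m" for n
      proof -
        have "(\<integral>\<^sup>+x. ennreal ((norm (v m x - v n x))\<^sup>2) \<partial>torus) = ennreal ((l2_norm (\<lambda>x. v m x - v n x))\<^sup>2)"
          by (intro nn_integral_square_L2 L2_diff v)
        moreover have "l2_norm (\<lambda>x. v m x - v n x) \<le> 2 * C * (1 / 2) ^ m"
          using far[of m "n - m"] that by (simp add: l2_norm_minus_commute[of "v m"])
        ultimately show ?thesis
          by (simp only:) (intro ennreal_leI power_mono l2_norm_nonneg)
      qed
    qed
    finally show ?thesis .
  qed
  have diff: "(\<lambda>x. v m x - v' x) \<in> L2" for m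
  proof (rule L2_I)
    show "(\<lambda>x. v m x - v' x) \<in> borel_measurable torus"
      by (intro borel_measurable_diff meas L2_measurable v)
    then show "integrable torus (\<lambda>x. (norm (v m x - v' x))\<^sup>2)"
      using fatou[of m] by (intro integrableI_bounded) (simp_all add: order_le_less_trans)
  qed (use L2_periodic[OF v[of m]] per in \<open>simp add: periodic_def\<close>)
  have "v' \<in> L2"
    using L2_diff[OF v[of 0] diff[of 0]] by (simp only: diff_diff_eq2 add_diff_cancel_left')
  have bound: "norm (l2_norm (\<lambda>x. v m x - v' x)) \<le> 2 * C * (1 / 2) ^ m" for m
  proof -
    have "ennreal ((l2_norm (\<lambda>x. v m x - v' x))\<^sup>2) \<le> ennreal ((2 * C * (1 / 2) ^ m)\<^sup>2)"
      using fatou[of m] by (simp only: nn_integral_square_L2[OF diff])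
    then have "(l2_norm (\<lambda>x. v m x - v' x))\<^sup>2 \<le> (2 * C * (1 / 2) ^ m)\<^sup>2"
      by (subst (asm) ennreal_le_iff) simp_all
    then have "l2_norm (\<lambda>x. v m x - v' x) \<le> 2 * C * (1 / 2) ^ m"
      by (rule power2_le_imp_le) (simp add: C)
    then show ?thesis by (simp only: real_norm_def abs_of_nonneg[OF l2_norm_nonneg])
  qed
  have geo: "(\<lambda>m. 2 * C * (1 / 2) ^ m) \<longlonglongrightarrow> 0"
    by (intro tendsto_mult_right_zero LIMSEQ_realpow_zero) auto
  have "(\<lambda>m. l2_norm (\<lambda>x. v m x - v' x)) \<longlonglongrightarrow> 0"
    by (rule Lim_null_comparison[OF always_eventually geo]) (rule allI, rule bound)
  with \<open>v' \<in> L2\<close> show ?thesis by blast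
qed

text \<open>Every closed subspace used is of this form: \<open>L2_sigma\<close> is the complement of
  the smooth gradients, and a closed linear span is obtained as a double complement. Closedness is
  then just continuity of the inner product, and no topology on L^2 has to be set up.\<close>

definition orthogonal_complement :: "(R3 \<Rightarrow> 'b::euclidean_space) set \<Rightarrow> (R3 \<Rightarrow> 'b) set" where
  "orthogonal_complement W = {v \<in> L2. \<forall>w\<in>W. l2_inner v w = 0}"

text \<open>Classical minimisation of the distance from f: the parallelogram law makes a minimising
  sequence Cauchy, and the first variation at its limit is the asserted orthogonality.\<close>

lemma projection_exists:
  fixes f :: "R3 \<Rightarrow> 'b::euclidean_space"
  assumes W: "W \<subseteq> L2" and f: "f \<in> L2"
  shows "\<exists>g\<in>orthogonal_complement W. \<forall>z\<in>orthogonal_complement W. l2_inner (\<lambda>x. f x - g x) z = 0"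
proof -
  let ?V = "orthogonal_complement W"
  have VL2: "v \<in> L2" if "v \<in> ?V" for v using that by (simp add: orthogonal_complement_def)
  have Vadd: "(\<lambda>x. u x + v x) \<in> ?V" if "u \<in> ?V" "v \<in> ?V" for u v
    using that W by (auto simp: orthogonal_complement_def L2_add l2_inner_add_left)
  have Vscale: "(\<lambda>x. c *\<^sub>R v x) \<in> ?V" if "v \<in> ?V" for c v
    using that by (auto simp: orthogonal_complement_def L2_scaleR l2_inner_scaleR)
  have V0: "(\<lambda>x. 0) \<in> ?V"
    using L2_const[of 0] by (simp add: orthogonal_complement_def l2_inner_def)
  define D where "D v = l2_inner (\<lambda>x. f x - v x) (\<lambda>x. f x - v x)" for v
  define d where "d = (INF v\<in>?V. D v)"
  have bdd: "bdd_below (D ` ?V)"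
    by (intro bdd_belowI[of _ 0]) (auto simp: D_def l2_inner_self_nonneg)
  have lower: "d \<le> D v" if "v \<in> ?V" for v
    unfolding d_def by (rule cINF_lower[OF bdd that])
  \<comment> \<open>The tolerance \<open>(1 / 4) ^ n\<close> is for squared distances; after the
    parallelogram law and a square root it becomes the rate \<open>(1 / 2) ^ n\<close> that
    \<open>Riesz_Fischer\<close> expects.\<close>
  have "\<exists>v\<in>?V. D v < d + (1 / 4) ^ n" for n
    using cINF_less_iff[of ?V D "d + (1 / 4) ^ n"] V0 bdd unfolding d_def by auto
  then obtain v where vV: "\<And>n. v n \<in> ?V" and vd: "\<And>n. D (v n) < d + (1 / 4) ^ n"
    by metis
  have vL2: "v n \<in> L2" for n by (rule VL2[OF vV])
  have parallelogram:
    "l2_inner (\<lambda>x. u x - v x) (\<lambda>x. u x - v x) \<le> 2 * (D u - d) + 2 * (D v - d)"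
    if "u \<in> ?V" "v \<in> ?V" for u v
  proof -
    let ?m = "\<lambda>x. (1 / 2) *\<^sub>R (u x + v x)"
    have uv: "u \<in> L2" "v \<in> L2" using that VL2 by auto
    have "l2_inner (\<lambda>x. u x - v x) (\<lambda>x. u x - v x) + 4 * D ?m = 2 * D u + 2 * D v"
      using uv f by (simp add: D_def l2_inner_diff_left l2_inner_diff_right l2_inner_add_left l2_inner_add_right
          l2_inner_scaleR L2_add L2_diff L2_scaleR l2_inner_commute[of u f] l2_inner_commute[of v f]
          l2_inner_commute[of v u] algebra_simps)
    moreover have "d \<le> D ?m" by (intro lower Vscale Vadd that)
    ultimately show ?thesis by simp
  qed
  have "l2_norm (\<lambda>x. v (Suc n) x - v n x) \<le> 2 * (1 / 2) ^ n" for n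
  proof (rule power2_le_imp_le)
    have "(l2_norm (\<lambda>x. v (Suc n) x - v n x))\<^sup>2 \<le> 2 * (D (v (Suc n)) - d) + 2 * (D (v n) - d)"
      unfolding l2_norm_square by (rule parallelogram[OF vV vV])
    also have "\<dots> \<le> 2 * (1 / 4) ^ Suc n + 2 * (1 / 4) ^ n"
      using vd[of n] vd[of "Suc n"] by (intro add_mono mult_left_mono) auto
    also have "\<dots> \<le> 4 * (1 / 4) ^ n" by simp
    also have "\<dots> = (2 * (1 / 2) ^ n)\<^sup>2"
      by (simp add: power_mult_distrib power2_eq_square flip: power_mult_distrib)
    finally show "(l2_norm (\<lambda>x. v (Suc n) x - v n x))\<^sup>2 \<le> (2 * (1 / 2) ^ n)\<^sup>2" .
  qed simp
  from Riesz_Fischer[OF vL2 this] obtain g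
    where gL2: "g \<in> L2" and lim: "(\<lambda>n. l2_norm (\<lambda>x. v n x - g x)) \<longlonglongrightarrow> 0"
    by blast
  have gV: "g \<in> ?V"
  proof -
    have "l2_inner g w = 0" if "w \<in> W" for w
    proof -
      have "(\<lambda>n. l2_inner (v n) w) \<longlonglongrightarrow> l2_inner g w"
        using that W by (intro tendsto_l2_inner vL2 gL2 lim) auto
      moreover have "l2_inner (v n) w = 0" for n
        using vV that by (auto simp: orthogonal_complement_def)
      ultimately show ?thesis
        by (simp add: LIMSEQ_const_iff)
    qed
    then show ?thesis by (simp add: orthogonal_complement_def gL2)
  qed
  have "(\<lambda>n. l2_norm (\<lambda>x. f x - v n x)) \<longlonglongrightarrow> l2_norm (\<lambda>x. f x - g x)"
  proof (rule LIM_zero_cancel, rule Lim_null_comparison[OF always_eventually lim], rule allI)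
    fix n
    have "(\<lambda>x. (f x - v n x) - (f x - g x)) = (\<lambda>x. g x - v n x)" by simp
    then show "norm (l2_norm (\<lambda>x. f x - v n x) - l2_norm (\<lambda>x. f x - g x)) \<le> l2_norm (\<lambda>x. v n x - g x)"
      using l2_norm_reverse_triangle[OF L2_diff[OF f vL2[of n]] L2_diff[OF f gL2]]
      by (simp add: l2_norm_minus_commute[of g])
  qed
  then have "(\<lambda>n. D (v n)) \<longlonglongrightarrow> D g"
    unfolding D_def l2_norm_square[symmetric] by (rule tendsto_power)
  moreover have "(\<lambda>n. d + (1 / 4) ^ n) \<longlonglongrightarrow> d + 0"
    by (intro tendsto_intros LIMSEQ_realpow_zero) auto
  ultimately have "D g \<le> d + 0"
    by (rule LIMSEQ_le) (use vd less_imp_le in blast)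
  then have Dg: "D g \<le> d" by simp
  have "l2_inner (\<lambda>x. f x - g x) z = 0" if z: "z \<in> ?V" for z
  proof -
    have zL2: "z \<in> L2" by (rule VL2[OF z])
    \<comment> \<open>The competitor g - t z stays in the subspace, so minimality of g leaves a
      quadratic in t with no constant term that is never negative.\<close>
    have "0 \<le> 0 + 2 * t * l2_inner (\<lambda>x. f x - g x) z + t\<^sup>2 * l2_inner z z" for t
    proof -
      have "d \<le> D (\<lambda>x. g x + (- t) *\<^sub>R z x)" by (intro lower Vadd Vscale gV z)
      also have "\<dots> = D g + 2 * t * l2_inner (\<lambda>x. f x - g x) z + t\<^sup>2 * l2_inner z z"
        using zL2 gL2 f by (simp add: D_def l2_inner_diff_left l2_inner_diff_right l2_inner_add_left
            l2_inner_add_right l2_inner_scaleR L2_add L2_diff L2_scaleR l2_inner_commute[of g f]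
            l2_inner_commute[of z f] l2_inner_commute[of z g] algebra_simps power2_eq_square)
      finally show ?thesis using Dg by simp
    qed
    from nonneg_quadratic_discriminant[OF this l2_inner_self_nonneg] show ?thesis by simp
  qed
  with gV show ?thesis by blast
qed

section \<open>Smooth periodic functions\<close>

text \<open>The product rule mixes derivatives of one factor with the other factor itself, so the
  induction in \<open>Ck_on_mult\<close> needs the undifferentiated factors one order lower.\<close>

lemma Ck_on_lower: "Ck_on (Suc k) S f \<Longrightarrow> Ck_on k S f"
proof (induction k arbitrary: f)
  case 0
  then obtain f' where "\<forall>x\<in>S. (f has_derivative f' x) (at x within S)" by auto
  then show ?case
    by (auto intro: has_derivative_continuous simp: continuous_on_eq_continuous_within)
next
  case (Suc k)
  from Suc.prems obtain f' where f': "\<forall>x\<in>S. (f has_derivative f' x) (at x within S)"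
      "\<And>v. Ck_on (Suc k) S (\<lambda>x. f' x v)"
    by (auto simp del: Ck_on.simps simp: Ck_on.simps(2)[of "Suc k"])
  from f'(2)[THEN Suc.IH] f'(1) show ?case by auto
qed

lemma Ck_on_bounded_linear: "bounded_linear h \<Longrightarrow> Ck_on k S f \<Longrightarrow> Ck_on k S (\<lambda>x. h (f x))"
proof (induction k arbitrary: f)
  case 0
  then show ?case by (auto intro: bounded_linear.continuous_on)
next
  case (Suc k)
  from Suc.prems(2) obtain f' where f': "\<forall>x\<in>S. (f has_derivative f' x) (at x within S)"
      "\<And>v. Ck_on k S (\<lambda>x. f' x v)" by auto
  show ?case
    using f'(1) f'(2)[THEN Suc.IH[OF Suc.prems(1)]]
    by (auto intro!: exI[of _ "\<lambda>x v. h (f' x v)"] bounded_linear.has_derivative[OF Suc.prems(1)])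
qed

lemma Ck_on_add: "Ck_on k S f \<Longrightarrow> Ck_on k S g \<Longrightarrow> Ck_on k S (\<lambda>x. f x + g x)"
proof (induction k arbitrary: f g)
  case 0
  then show ?case by (auto intro: continuous_on_add)
next
  case (Suc k)
  from Suc.prems obtain f' g' where f': "\<forall>x\<in>S. (f has_derivative f' x) (at x within S)"
      "\<And>v. Ck_on k S (\<lambda>x. f' x v)" and g': "\<forall>x\<in>S. (g has_derivative g' x) (at x within S)"
      "\<And>v. Ck_on k S (\<lambda>x. g' x v)" by auto
  show ?case
    using f'(1) g'(1) Suc.IH[OF f'(2) g'(2)]
    by (auto intro!: exI[of _ "\<lambda>x v. f' x v + g' x v"] has_derivative_add)
qed

lemma Ck_on_mult:
  fixes f g :: "'a::euclidean_space \<Rightarrow> real"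
  shows "Ck_on k S f \<Longrightarrow> Ck_on k S g \<Longrightarrow> Ck_on k S (\<lambda>x. f x * g x)"
proof (induction k arbitrary: f g)
  case 0
  then show ?case by (auto intro: continuous_on_mult)
next
  case (Suc k)
  from Suc.prems obtain f' g' where f': "\<forall>x\<in>S. (f has_derivative f' x) (at x within S)"
      "\<And>v. Ck_on k S (\<lambda>x. f' x v)" and g': "\<forall>x\<in>S. (g has_derivative g' x) (at x within S)"
      "\<And>v. Ck_on k S (\<lambda>x. g' x v)" by auto
  have "Ck_on k S (\<lambda>x. f x * g' x v + f' x v * g x)" for v
    by (intro Ck_on_add Suc.IH f' g' Ck_on_lower[OF Suc.prems(1)] Ck_on_lower[OF Suc.prems(2)])
  then show ?case
    using f'(1) g'(1)
    by (auto intro!: exI[of _ "\<lambda>x v. f x * g' x v + f' x v * g x"] has_derivative_mult)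
qed

lemma smooth_torus_Ck: "smooth_torus f \<Longrightarrow> Ck_on k UNIV f"
  and smooth_torus_periodic: "smooth_torus f \<Longrightarrow> periodic f"
  by (simp_all add: smooth_torus_def smooth_on_def)

lemma smooth_torus_continuous: "smooth_torus f \<Longrightarrow> continuous_on UNIV f"
  using smooth_torus_Ck[of f 0] by simp

lemma smooth_torus_has_derivative:
  assumes "smooth_torus f"
  shows "(f has_derivative frechet_derivative f (at x)) (at x)"
proof -
  obtain f' where "\<forall>x\<in>UNIV. (f has_derivative f' x) (at x within UNIV)"
    using smooth_torus_Ck[OF assms, of "Suc 0"] by auto
  then show ?thesis
    using frechet_derivative_works differentiable_def by blast
qed

lemma partial_eqI: "(f has_derivative f') (at x) \<Longrightarrow> partial i f x = f' (axis i 1)"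
  by (simp add: partial_def frechet_derivative_at[symmetric])

lemma smooth_torus_partial:
  assumes "smooth_torus f"
  shows "smooth_torus (partial i f)"
proof -
  have "Ck_on k UNIV (partial i f)" for k
  proof -
    obtain f' where f': "\<forall>x\<in>UNIV. (f has_derivative f' x) (at x within UNIV)"
        "\<And>v. Ck_on k UNIV (\<lambda>x. f' x v)"
      using smooth_torus_Ck[OF assms, of "Suc k"] by auto
    then have "partial i f = (\<lambda>x. f' x (axis i 1))"
      by (auto simp: partial_eqI)
    with f'(2) show ?thesis by simp
  qed
  \<comment> \<open>Precomposing f with a translation by a period gives f back, so the derivative at
    the translated point is also a derivative at x, and derivatives are unique.\<close>
  moreover have "partial i f (x + (2 * pi) *\<^sub>R axis j 1) = partial i f x" for x j
  proof -
    let ?p = "(2 * pi) *\<^sub>R axis j (1::real) :: R3"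
    have "((\<lambda>y. f (y + ?p)) has_derivative frechet_derivative f (at (x + ?p))) (at x)"
      by (rule has_derivative_compose[of "\<lambda>y. y + ?p" "\<lambda>h. h", OF _ smooth_torus_has_derivative[OF assms]])
         (auto intro!: derivative_eq_intros)
    moreover have "(\<lambda>y. f (y + ?p)) = f"
      using smooth_torus_periodic[OF assms] by (simp add: periodic_def)
    ultimately have "(f has_derivative frechet_derivative f (at (x + ?p))) (at x)" by simp
    from partial_eqI[OF this, of i] show ?thesis
      by (simp add: partial_def)
  qed
  ultimately show ?thesis
    by (simp add: smooth_torus_def smooth_on_def periodic_def)
qed

lemma smooth_torus_mult:
  fixes f g :: "R3 \<Rightarrow> real"
  assumes "smooth_torus f" "smooth_torus g"
  shows "smooth_torus (\<lambda>x. f x * g x)"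
  using assms by (simp add: smooth_torus_def smooth_on_def periodic_def Ck_on_mult)

lemma smooth_torus_bounded_linear:
  assumes "smooth_torus f" "bounded_linear h"
  shows "smooth_torus (\<lambda>x. h (f x))"
  using assms by (simp add: smooth_torus_def smooth_on_def periodic_def Ck_on_bounded_linear)

lemma partial_mult:
  fixes f g :: "R3 \<Rightarrow> real"
  assumes "smooth_torus f" "smooth_torus g"
  shows "partial i (\<lambda>x. f x * g x) x = f x * partial i g x + partial i f x * g x"
  unfolding partial_eqI[OF has_derivative_mult[OF assms[THEN smooth_torus_has_derivative]]]
  by (simp add: partial_def)

lemma partial_bounded_linear:
  assumes "smooth_torus f" "bounded_linear h"
  shows "partial i (\<lambda>x. h (f x)) x = h (partial i f x)"
  unfolding partial_eqI[OF bounded_linear.has_derivative[OF assms(2) smooth_torus_has_derivative[OF assms(1)]]]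
  by (simp add: partial_def)

lemma smooth_torus_nth: "smooth_torus f \<Longrightarrow> smooth_torus (\<lambda>x. f x $ i)"
  by (rule smooth_torus_bounded_linear[OF _ bounded_linear_vec_nth])

lemma partial_nth: "smooth_torus f \<Longrightarrow> partial i (\<lambda>x. f x $ j) x = partial i f x $ j"
  by (rule partial_bounded_linear[OF _ bounded_linear_vec_nth])

lemma continuous_integrable_torus:
  fixes f :: "R3 \<Rightarrow> 'b::euclidean_space"
  shows "continuous_on UNIV f \<Longrightarrow> integrable torus f"
  unfolding torus_def by (rule continuous_imp_integrable) (rule continuous_on_subset, auto)

lemma continuous_L2:
  fixes f :: "R3 \<Rightarrow> 'b::euclidean_space"
  assumes "continuous_on UNIV f" "periodic f"
  shows "f \<in> L2"
proof (rule L2_I[OF assms(2)])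
  show "f \<in> borel_measurable torus"
    by (rule borel_measurable_integrable[OF continuous_integrable_torus[OF assms(1)]])
  show "integrable torus (\<lambda>x. (norm (f x))\<^sup>2)"
    by (intro continuous_integrable_torus continuous_intros assms(1))
qed

lemma smooth_torus_L2:
  fixes f :: "R3 \<Rightarrow> 'b::euclidean_space"
  shows "smooth_torus f \<Longrightarrow> f \<in> L2"
  by (intro continuous_L2 smooth_torus_continuous smooth_torus_periodic)

section \<open>Translation invariance on the torus and integration by parts\<close>

lemma integral_torus_HK:
  fixes f :: "R3 \<Rightarrow> real"
  assumes "continuous_on UNIV f"
  shows "(LINT x|torus. f x) = integral (cbox 0 (\<chi> i. 2 * pi)) f"
  using continuous_integrable_torus[OF assms] unfolding torus_def
  by (intro lebesgue_integral_eq_integral) auto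

text \<open>Cut the cell at height h in direction i. The translated cell consists of the upper piece
  and of the lower piece moved up by one period, over which f has the same integral.\<close>

lemma integral_torus_shift:
  fixes f :: "R3 \<Rightarrow> real"
  assumes cont: "continuous_on UNIV f" and per: "periodic f" and h: "0 \<le> h" "h \<le> 2 * pi"
  shows "(LINT x|torus. f (x + h *\<^sub>R axis i 1)) = (LINT x|torus. f x)"
proof -
  define e :: R3 where "e = axis i 1"
  define P :: R3 where "P = (\<chi> i. 2 * pi)"
  have e: "e \<in> Basis" by (simp add: e_def axis_in_Basis_iff)
  have nth: "x \<bullet> e = x $ i" for x by (simp add: e_def inner_axis)
  have ej: "e $ j = (if j = i then 1 else 0)" for j by (simp add: e_def axis_def)
  have int: "f integrable_on cbox a b" for a b
    by (rule integrable_continuous[OF continuous_on_subset[OF cont]]) simp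
  have hint: "(f has_integral integral (cbox a b) f) (cbox a b)" for a b
    by (rule integrable_integral[OF int])
  \<comment> \<open>The corner \<open>P + h *\<^sub>R e - (2 * pi) *\<^sub>R e\<close> is
    \<open>P\<close> with its i-th coordinate replaced by h.\<close>
  have "(f has_integral integral (cbox 0 (P + h *\<^sub>R e - (2 * pi) *\<^sub>R e)) f + integral (cbox (h *\<^sub>R e) P) f) (cbox 0 P)"
  proof (rule has_integral_split[OF _ _ e, where c = h])
    have "cbox 0 P \<inter> {x. x \<bullet> e \<le> h} = cbox 0 (P + h *\<^sub>R e - (2 * pi) *\<^sub>R e)"
      using h by (force simp: set_eq_iff mem_box_cart nth ej P_def split: if_splits)
    then show "(f has_integral integral (cbox 0 (P + h *\<^sub>R e - (2 * pi) *\<^sub>R e)) f) (cbox 0 P \<inter> {x. x \<bullet> e \<le> h})"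
      by (simp only: hint)
    have "cbox 0 P \<inter> {x. x \<bullet> e \<ge> h} = cbox (h *\<^sub>R e) P"
      using h by (force simp: set_eq_iff mem_box_cart nth ej P_def split: if_splits)
    then show "(f has_integral integral (cbox (h *\<^sub>R e) P) f) (cbox 0 P \<inter> {x. x \<bullet> e \<ge> h})"
      by (simp only: hint)
  qed
  moreover have "(f has_integral integral (cbox (h *\<^sub>R e) P) f + integral (cbox ((2 * pi) *\<^sub>R e) (P + h *\<^sub>R e)) f)
      (cbox (h *\<^sub>R e) (P + h *\<^sub>R e))"
  proof (rule has_integral_split[OF _ _ e, where c = "2 * pi"])
    have "cbox (h *\<^sub>R e) (P + h *\<^sub>R e) \<inter> {x. x \<bullet> e \<le> 2 * pi} = cbox (h *\<^sub>R e) P"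
      using h by (force simp: set_eq_iff mem_box_cart nth ej P_def split: if_splits)
    then show "(f has_integral integral (cbox (h *\<^sub>R e) P) f) (cbox (h *\<^sub>R e) (P + h *\<^sub>R e) \<inter> {x. x \<bullet> e \<le> 2 * pi})"
      by (simp only: hint)
    have "cbox (h *\<^sub>R e) (P + h *\<^sub>R e) \<inter> {x. x \<bullet> e \<ge> 2 * pi} = cbox ((2 * pi) *\<^sub>R e) (P + h *\<^sub>R e)"
      using h by (force simp: set_eq_iff mem_box_cart nth ej P_def split: if_splits)
    then show "(f has_integral integral (cbox ((2 * pi) *\<^sub>R e) (P + h *\<^sub>R e)) f)
        (cbox (h *\<^sub>R e) (P + h *\<^sub>R e) \<inter> {x. x \<bullet> e \<ge> 2 * pi})"
      by (simp only: hint)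
  qed
  moreover have "integral (cbox ((2 * pi) *\<^sub>R e) (P + h *\<^sub>R e)) f = integral (cbox 0 (P + h *\<^sub>R e - (2 * pi) *\<^sub>R e)) f"
    using integral_shift_cbox[of "(2 * pi) *\<^sub>R e" "(2 * pi) *\<^sub>R e" "P + h *\<^sub>R e" f] per
    by (simp add: periodic_def e_def)
  moreover have "integral (cbox 0 P) (\<lambda>x. f (x + h *\<^sub>R e)) = integral (cbox (h *\<^sub>R e) (P + h *\<^sub>R e)) f"
    using integral_shift_cbox[of "h *\<^sub>R e" "h *\<^sub>R e" "P + h *\<^sub>R e" f] by simp
  ultimately have "integral (cbox 0 P) (\<lambda>x. f (x + h *\<^sub>R e)) = integral (cbox 0 P) f"
    by (auto dest!: integral_unique)
  then show ?thesis
    using cont unfolding e_def P_def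
    by (subst (1 2) integral_torus_HK) (auto intro!: continuous_intros continuous_on_compose2[OF cont])
qed

lemma has_derivative_line:
  fixes f :: "R3 \<Rightarrow> real"
  assumes "smooth_torus f"
  shows "((\<lambda>t. f (x + t *\<^sub>R axis i 1)) has_real_derivative partial i f (x + t *\<^sub>R axis i 1)) (at t)"
proof -
  let ?D = "frechet_derivative f (at (x + t *\<^sub>R axis i 1))"
  have "((\<lambda>t. f (x + t *\<^sub>R axis i 1)) has_derivative (\<lambda>s. ?D (s *\<^sub>R axis i 1))) (at t)"
    by (rule has_derivative_compose[OF _ smooth_torus_has_derivative[OF assms]])
       (auto intro!: derivative_eq_intros)
  moreover have "?D (s *\<^sub>R axis i 1) = partial i f (x + t *\<^sub>R axis i 1) * s" for s
    using has_derivative_linear[OF smooth_torus_has_derivative[OF assms]]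
    by (simp add: linear_scale partial_def)
  ultimately show ?thesis
    by (simp add: has_field_derivative_def mult_commute_abs)
qed

text \<open>The difference quotients of f in direction i have integral zero by translation
  invariance, and dominated convergence carries this over to the derivative. Integration by parts
  follows by applying it to products.\<close>

lemma integral_partial_zero:
  fixes f :: "R3 \<Rightarrow> real"
  assumes f: "smooth_torus f"
  shows "(LINT x|torus. partial i f x) = 0"
proof -
  let ?e = "axis i 1 :: R3"
  define h :: "nat \<Rightarrow> real" where "h n = 1 / Suc n" for n
  have h: "0 < h n" "h n \<le> 1" for n by (auto simp: h_def)
  have h0: "h \<longlonglongrightarrow> 0"
    using LIMSEQ_inverse_real_of_nat by (simp add: h_def[abs_def] inverse_eq_divide)
  define q where "q n x = (f (x + h n *\<^sub>R ?e) - f x) / h n" for n x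
  have cf: "continuous_on UNIV f" by (rule smooth_torus_continuous[OF f])
  have cq: "continuous_on UNIV (q n)" for n
    unfolding q_def using h(1)[of n]
    by (intro continuous_intros continuous_on_compose2[OF cf]) auto
  have cp: "continuous_on UNIV (partial i f)"
    by (intro smooth_torus_continuous smooth_torus_partial f)
  have "(LINT x|torus. q n x) = 0" for n
  proof -
    have "integrable torus (\<lambda>x. f (x + h n *\<^sub>R ?e))"
      by (intro continuous_integrable_torus continuous_intros continuous_on_compose2[OF cf]) auto
    moreover have "h n \<le> 2 * pi" using h(2)[of n] pi_gt3 by simp
    ultimately show ?thesis
      using integral_torus_shift[OF cf smooth_torus_periodic[OF f], of "h n" i] h(1)[of n]
        continuous_integrable_torus[OF cf]
      by (simp add: q_def)
  qed
  moreover have "(\<lambda>n. LINT x|torus. q n x) \<longlonglongrightarrow> (LINT x|torus. partial i f x)"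
  proof -
    \<comment> \<open>The mean value theorem evaluates the derivative at points up to distance
      \<open>h n \<le> 1\<close> beyond the cell, hence the box enlarged by 1.\<close>
    let ?K = "cbox 0 (\<chi> i. 2 * pi + 1) :: R3 set"
    have "bounded (partial i f ` ?K)"
      by (intro compact_imp_bounded compact_continuous_image continuous_on_subset[OF cp]) auto
    then obtain M where M: "\<And>x. x \<in> ?K \<Longrightarrow> \<bar>partial i f x\<bar> \<le> M"
      by (auto simp: bounded_iff)
    show ?thesis
    proof (rule integral_dominated_convergence[where w = "\<lambda>x. M"])
      show "AE x in torus. (\<lambda>n. q n x) \<longlonglongrightarrow> partial i f x"
      proof (rule AE_I2)
        fix x
        have "((\<lambda>t. (f (x + t *\<^sub>R ?e) - f x) / t) \<longlongrightarrow> partial i f x) (at 0)"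
          using has_derivative_line[OF f, of x i 0] by (simp add: DERIV_def)
        moreover have "filterlim h (at 0) sequentially"
          using h0 h(1) by (auto simp: filterlim_at intro!: always_eventually) (metis less_irrefl)
        ultimately show "(\<lambda>n. q n x) \<longlonglongrightarrow> partial i f x"
          unfolding q_def by (rule filterlim_compose)
      qed
      show "AE x in torus. norm (q n x) \<le> M" for n
      proof (rule AE_I2)
        fix x assume x: "x \<in> space torus"
        obtain z where z: "0 < z" "z < h n"
          "f (x + h n *\<^sub>R ?e) - f (x + 0 *\<^sub>R ?e) = (h n - 0) * partial i f (x + z *\<^sub>R ?e)"
          using MVT2[OF h(1), of n "\<lambda>t. f (x + t *\<^sub>R ?e)" "\<lambda>t. partial i f (x + t *\<^sub>R ?e)"]
            has_derivative_line[OF f] by blast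
        have "q n x = partial i f (x + z *\<^sub>R ?e)"
          using z(3) h(1)[of n] by (simp add: q_def)
        moreover have "x + z *\<^sub>R ?e \<in> ?K"
          using x z h(2)[of n] by (auto simp: mem_box_cart axis_def) (smt (verit))+
        ultimately show "norm (q n x) \<le> M" using M by simp
      qed
    qed (auto intro!: borel_measurable_integrable continuous_integrable_torus cq cp)
  qed
  ultimately show ?thesis
    by (simp add: LIMSEQ_const_iff)
qed

section \<open>Completeness of the trigonometric system\<close>

text \<open>The free phase covers cosines and sines at once and keeps the family real and closed
  under differentiation up to factors: a derivative only advances the phase by a quarter
  period.\<close>

definition wave :: "R3 \<Rightarrow> real \<Rightarrow> R3 \<Rightarrow> real" where
  "wave k c x = cos (k \<bullet> x + c)"

text \<open>The lattice dual to the periods; integrality is what makes a wave periodic.\<close>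

definition frequencies :: "R3 set" where
  "frequencies = {k. \<forall>i. k $ i \<in> \<int>}"

lemma wave_has_derivative:
  "(wave k c has_derivative (\<lambda>v. (k \<bullet> v) * wave k (c + pi / 2) x)) (at x within S)"
proof -
  have "cos (k \<bullet> x + (c + pi / 2)) = - sin (k \<bullet> x + c)"
    using minus_sin_cos_eq[of "k \<bullet> x + c"] by (simp add: add.assoc)
  then show ?thesis
    unfolding wave_def[abs_def] by (auto intro!: derivative_eq_intros)
qed

lemma Ck_on_wave: "Ck_on n S (\<lambda>x. a * wave k c x)"
proof (induction n arbitrary: a c)
  case 0
  show ?case by (auto simp: wave_def intro!: continuous_intros)
next
  case (Suc n)
  have "((\<lambda>x. a * wave k c x) has_derivative (\<lambda>v. a * ((k \<bullet> v) * wave k (c + pi / 2) x))) (at x within S)" for x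
    by (intro has_derivative_mult_right wave_has_derivative)
  moreover have "Ck_on n S (\<lambda>x. a * ((k \<bullet> v) * wave k (c + pi / 2) x))" for v
    using Suc[of "a * (k \<bullet> v)" "c + pi / 2"] by (simp add: mult.assoc)
  ultimately show ?case
    by (auto intro!: exI[of _ "\<lambda>x v. a * ((k \<bullet> v) * wave k (c + pi / 2) x)"])
qed

lemma smooth_torus_wave:
  assumes "k \<in> frequencies"
  shows "smooth_torus (wave k c)"
proof -
  have "wave k c (x + (2 * pi) *\<^sub>R axis i 1) = wave k c x" for x i
  proof -
    obtain n :: int where "k $ i = of_int n"
      using assms by (auto simp: frequencies_def Ints_def)
    then have "k \<bullet> (x + (2 * pi) *\<^sub>R axis i 1) + c = (k \<bullet> x + c) + 2 * pi * of_int n"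
      by (simp add: inner_add_right inner_axis)
    then show ?thesis
      by (simp only: wave_def) (metis sin_cos_eq_iff)
  qed
  then show ?thesis
    using Ck_on_wave[of _ UNIV 1 k c] by (simp add: smooth_torus_def smooth_on_def periodic_def)
qed

lemma partial_wave: "partial i (wave k c) x = k $ i * wave k (c + pi / 2) x"
  by (simp add: partial_eqI[OF wave_has_derivative] inner_axis)

lemma frequencies_add: "k \<in> frequencies \<Longrightarrow> l \<in> frequencies \<Longrightarrow> k + l \<in> frequencies"
  and frequencies_diff: "k \<in> frequencies \<Longrightarrow> l \<in> frequencies \<Longrightarrow> k - l \<in> frequencies"
  and frequencies_zero: "0 \<in> frequencies"
  and frequencies_axis: "axis i 1 \<in> frequencies"
  by (simp_all add: frequencies_def axis_def)

inductive trig_poly :: "(R3 \<Rightarrow> real) \<Rightarrow> bool" where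
  wave: "k \<in> frequencies \<Longrightarrow> trig_poly (\<lambda>x. a * wave k c x)"
| add: "trig_poly f \<Longrightarrow> trig_poly g \<Longrightarrow> trig_poly (\<lambda>x. f x + g x)"

lemma trig_poly_const: "trig_poly (\<lambda>x. a)"
  using trig_poly.wave[OF frequencies_zero, of a 0] by (simp add: wave_def)

lemma trig_poly_sum: "(\<And>i. i \<in> I \<Longrightarrow> trig_poly (f i)) \<Longrightarrow> trig_poly (\<lambda>x. \<Sum>i\<in>I. f i x)"
  by (induction I rule: infinite_finite_induct) (auto intro: trig_poly_const trig_poly.add)

text \<open>Product-to-sum formula: the sum and the difference of two frequencies stay in the
  lattice.\<close>

lemma trig_poly_mult:
  assumes "trig_poly f" "trig_poly g"
  shows "trig_poly (\<lambda>x. f x * g x)"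
  using assms(1)
proof induction
  case (wave k a c)
  from assms(2) show ?case
  proof induction
    case (wave l b d)
    have "a * wave k c x * (b * wave l d x)
        = (a * b / 2) * wave (k - l) (c - d) x + (a * b / 2) * wave (k + l) (c + d) x" for x
    proof -
      define u v where "u = k \<bullet> x + c" and "v = l \<bullet> x + d"
      have "(k - l) \<bullet> x + (c - d) = u - v" "(k + l) \<bullet> x + (c + d) = u + v"
        by (simp_all add: u_def v_def inner_diff_left inner_add_left)
      then have "wave (k - l) (c - d) x = cos (u - v)" "wave (k + l) (c + d) x = cos (u + v)"
        by (simp_all only: wave_def)
      moreover have "wave k c x = cos u" "wave l d x = cos v" by (simp_all add: wave_def u_def v_def)
      moreover have "a * cos u * (b * cos v) = a * b * ((cos (u - v) + cos (u + v)) / 2)"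
        by (simp only: cos_times_cos[symmetric] mult_ac)
      moreover have "a * b * ((y + z) / 2) = a * b / 2 * y + a * b / 2 * z" for y z
        by (simp add: field_simps)
      ultimately show ?thesis by (simp only:)
    qed
    then show ?case
      using wave \<open>k \<in> frequencies\<close> by (simp only:) (intro trig_poly.intros frequencies_add frequencies_diff)
  next
    case (add f g)
    then show ?case by (simp add: distrib_left trig_poly.add)
  qed
next
  case (add f g)
  then show ?case by (simp add: distrib_right trig_poly.add)
qed

text \<open>Realises the torus as a compact subset of a Euclidean space, where the Stone-Weierstrass
  theorem for polynomials applies; a polynomial in these coordinates pulls back to a trigonometric
  polynomial.\<close>

definition cos_sin :: "R3 \<Rightarrow> R3 \<times> R3" where
  "cos_sin x = (\<chi> i. cos (x $ i), \<chi> i. sin (x $ i))"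

lemma continuous_cos_sin: "continuous_on S cos_sin"
  unfolding cos_sin_def[abs_def] by (intro continuous_intros)

lemma periodic_cos_sin: "periodic cos_sin"
  by (simp add: periodic_def cos_sin_def axis_def vec_eq_iff)

text \<open>Linear functions suffice as generators: the coordinates of \<open>cos_sin\<close> are
  waves along the axes with phases 0 and -pi/2, and products are handled by
  \<open>trig_poly_mult\<close>.\<close>

lemma trig_poly_polynomial:
  assumes "real_polynomial_function p"
  shows "trig_poly (\<lambda>x. p (cos_sin x))"
  using assms
proof induction
  case (linear f)
  interpret f: bounded_linear f by fact
  have "f (cos_sin x) = (\<Sum>i\<in>UNIV. f (axis i 1, 0) * wave (axis i 1) 0 x + f (0, axis i 1) * wave (axis i 1) (- (pi / 2)) x)"
    for x
  proof -
    have "cos_sin x = (\<Sum>i\<in>UNIV. cos (x $ i) *\<^sub>R (axis i 1, 0) + sin (x $ i) *\<^sub>R (0, axis i 1))"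
      by (simp add: cos_sin_def prod_eq_iff fst_sum snd_sum vec_eq_iff axis_def
          if_distrib[where f = "\<lambda>y. b * y" for b] cong: if_cong)
    then have "f (cos_sin x) = (\<Sum>i\<in>UNIV. cos (x $ i) * f (axis i 1, 0) + sin (x $ i) * f (0, axis i 1))"
      by (simp only: f.sum f.add f.scaleR real_scaleR_def)
    moreover have "wave (axis i 1) 0 x = cos (x $ i)" "wave (axis i 1) (- (pi / 2)) x = sin (x $ i)" for i
      by (simp_all add: wave_def inner_axis' cos_diff)
    ultimately show ?thesis by (simp add: mult.commute)
  qed
  then show ?case
    by (simp only:) (intro trig_poly_sum trig_poly.intros frequencies_axis)
next
  case (const c)
  show ?case by (rule trig_poly_const)
qed (auto intro: trig_poly.add trig_poly_mult)

lemma AE_torusI: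
  assumes "AE x in lebesgue. P x"
  shows "AE x in torus. P x"
  using assms unfolding torus_def by (subst AE_restrict_space_iff) auto

text \<open>Orthogonality to waves extends by uniform approximation to all continuous functions of
  \<open>cos_sin x\<close>. Truncated multiples of a distance function are of this kind and converge
  almost everywhere to the indicator of U.\<close>

lemma integral_indicator_open_zero:
  assumes f: "f \<in> L2" and orth: "\<And>k c. k \<in> frequencies \<Longrightarrow> l2_inner f (wave k c) = 0"
    and U: "open U"
  shows "(LINT x|torus. f x * indicator U x) = (0::real)"
proof -
  let ?K = "cbox 0 (\<chi> i. 2 * pi) :: R3 set" and ?B = "box 0 (\<chi> i. 2 * pi) :: R3 set"
  have fint: "integrable torus f"
    using integrable_inner_L2[OF f L2_const[of 1]] by simp
  have trig: "l2_inner f p = 0 \<and> continuous_on UNIV p \<and> periodic p" if "trig_poly p" for p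
    using that
  proof induction
    case (wave k a c)
    then show ?case
      using smooth_torus_continuous[OF smooth_torus_wave, of k c] smooth_torus_periodic[OF smooth_torus_wave, of k c]
        l2_inner_scaleR(2)[of f a "wave k c"]
      by (simp add: orth periodic_def continuous_on_mult_left)
  next
    case (add p q)
    then have "p \<in> L2" "q \<in> L2" by (auto intro: continuous_L2)
    with add show ?case
      by (simp add: l2_inner_add_right f continuous_on_add periodic_def)
  qed
  have cont: "(LINT x|torus. f x * g (cos_sin x)) = 0" if g: "continuous_on UNIV g" for g :: "R3 \<times> R3 \<Rightarrow> real"
  proof (rule ccontr)
    let ?A = "LINT x|torus. f x * g (cos_sin x)"
    assume "?A \<noteq> 0"
    define B where "B = (LINT x|torus. \<bar>f x\<bar>)"
    have "B \<ge> 0" by (simp add: B_def)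
    \<comment> \<open>Chosen so that an error of size e in the approximation changes the integral by
      at most half of its supposed nonzero value; the \<open>+ 1\<close> covers the case B =
      0.\<close>
    define e where "e = \<bar>?A\<bar> / (2 * (B + 1))"
    have e: "e > 0" using \<open>?A \<noteq> 0\<close> \<open>B \<ge> 0\<close> by (simp add: e_def)
    have "compact (cos_sin ` ?K)"
      by (intro compact_continuous_image continuous_cos_sin compact_cbox)
    then obtain p where p: "real_polynomial_function p"
        and pe: "\<And>y. y \<in> cos_sin ` ?K \<Longrightarrow> \<bar>g y - p y\<bar> < e"
      using Stone_Weierstrass_real_polynomial_function[OF _ continuous_on_subset[OF g] e] by blast
    have tp: "trig_poly (\<lambda>x. p (cos_sin x))" by (rule trig_poly_polynomial[OF p])
    have gE: "continuous_on UNIV (\<lambda>x. g (cos_sin x))"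
      by (rule continuous_on_compose2[OF g continuous_cos_sin]) auto
    have int1: "integrable torus (\<lambda>x. f x * g (cos_sin x))"
      using integrable_inner_L2[OF f continuous_L2[OF gE]] periodic_cos_sin by (simp add: periodic_def)
    have int2: "integrable torus (\<lambda>x. f x * p (cos_sin x))"
      using integrable_inner_L2[OF f continuous_L2] trig[OF tp] by simp
    have "?A = ?A - (LINT x|torus. f x * p (cos_sin x))"
      using trig[OF tp] by (simp add: l2_inner_def)
    also have "\<dots> = (LINT x|torus. f x * g (cos_sin x) - f x * p (cos_sin x))"
      using int1 int2 by simp
    finally have "\<bar>?A\<bar> = \<bar>LINT x|torus. f x * g (cos_sin x) - f x * p (cos_sin x)\<bar>" by simp
    also have "\<dots> \<le> (LINT x|torus. \<bar>f x * g (cos_sin x) - f x * p (cos_sin x)\<bar>)"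
      by (rule integral_abs_bound)
    also have "\<dots> \<le> (LINT x|torus. e * \<bar>f x\<bar>)"
    proof (rule integral_mono)
      fix x assume "x \<in> space torus"
      then have "\<bar>g (cos_sin x) - p (cos_sin x)\<bar> \<le> e"
        using pe[of "cos_sin x"] by (simp add: less_imp_le)
      then have "\<bar>f x\<bar> * \<bar>g (cos_sin x) - p (cos_sin x)\<bar> \<le> \<bar>f x\<bar> * e"
        by (rule mult_left_mono) simp
      then show "\<bar>f x * g (cos_sin x) - f x * p (cos_sin x)\<bar> \<le> e * \<bar>f x\<bar>"
        by (simp add: abs_mult[symmetric] right_diff_distrib mult.commute)
    qed (use int1 int2 fint in auto)
    also have "\<dots> = e * B" by (simp add: B_def)
    also have "\<dots> < \<bar>?A\<bar>"
    proof -
      have "e * B \<le> e * (B + 1)" using e by simp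
      also have "\<dots> = \<bar>?A\<bar> / 2" using \<open>B \<ge> 0\<close> by (simp add: e_def field_simps)
      also have "\<dots> < \<bar>?A\<bar>" using \<open>?A \<noteq> 0\<close> by simp
      finally show ?thesis .
    qed
    finally show False by simp
  qed
  \<comment> \<open>\<open>cos_sin\<close> glues opposite faces of the cell and is injective only in
    its interior. The whole boundary is therefore put into the closed set to be avoided, at the cost
    of a null set.\<close>
  define C where "C = cos_sin ` (?K - U \<inter> ?B)"
  have "compact (?K - U \<inter> ?B)"
    by (intro compact_diff open_Int U open_box compact_cbox)
  then have C: "closed C"
    unfolding C_def by (intro compact_imp_closed compact_continuous_image continuous_cos_sin)
  \<comment> \<open>The distance to the empty set is 0 by convention, so C has to be nonempty for
    \<open>infdist\<close> to separate points from it.\<close>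
  have "0 \<in> ?K - U \<inter> ?B" by (auto simp: mem_box_cart)
  then have Cne: "C \<noteq> {}" by (auto simp: C_def)
  have inC: "x \<in> U \<longleftrightarrow> cos_sin x \<notin> C" if x: "x \<in> ?B" for x
  proof -
    \<comment> \<open>Equal sines and cosines give coordinates that differ by a multiple of 2 pi.
      Since x is strictly inside the cell, the multiple lies strictly between -1 and 1.\<close>
    have "x = y" if y: "y \<in> ?K" and eq: "cos_sin x = cos_sin y" for y
    proof -
      have "x $ i = y $ i" for i
      proof -
        have "sin (x $ i) = sin (y $ i) \<and> cos (x $ i) = cos (y $ i)"
          using eq by (simp add: cos_sin_def vec_eq_iff)
        then obtain n :: int where n: "x $ i = y $ i + 2 * pi * n"
          using sin_cos_eq_iff by blast
        have "0 < x $ i" "x $ i < 2 * pi" "0 \<le> y $ i" "y $ i \<le> 2 * pi"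
          using x y by (simp_all add: mem_box_cart)
        then have "2 * pi * n < 2 * pi * 1" "2 * pi * (- 1) < 2 * pi * n"
          using n by linarith+
        then have "real_of_int n < 1" "- 1 < real_of_int n"
          by (simp_all only: mult_less_cancel_left_pos[OF mult_pos_pos[OF zero_less_numeral pi_gt_zero]])
        then have "n = 0" by linarith
        with n show ?thesis by simp
      qed
      then show ?thesis by (simp add: vec_eq_iff)
    qed
    moreover have "x \<in> ?K" using x box_subset_cbox by blast
    ultimately show ?thesis using x unfolding C_def by blast
  qed
  define g where "g n y = min 1 (real n * infdist y C)" for n y
  have cg: "continuous_on UNIV (g n)" for n
    unfolding g_def by (intro continuous_intros)
  have "(\<lambda>n. LINT x|torus. f x * g n (cos_sin x)) \<longlonglongrightarrow> (LINT x|torus. f x * indicator U x)"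
  proof (rule integral_dominated_convergence[where w = "\<lambda>x. \<bar>f x\<bar>"])
    have "AE x in lebesgue. x \<notin> ?K - ?B"
      using negligible_frontier_interval by (intro AE_not_in) (simp only: negligible_iff_null_sets[symmetric])
    then have "AE x in torus. x \<notin> ?K - ?B" by (rule AE_torusI)
    then show "AE x in torus. (\<lambda>n. f x * g n (cos_sin x)) \<longlonglongrightarrow> f x * indicator U x"
    proof (rule AE_mp, intro AE_I2 impI)
      fix x assume "x \<in> space torus" "x \<notin> ?K - ?B"
      then have x: "x \<in> ?B" by simp
      have "(\<lambda>n. g n (cos_sin x)) \<longlonglongrightarrow> indicator U x"
      proof (cases "x \<in> U")
        case True
        then have pos: "infdist (cos_sin x) C > 0"
          using inC[OF x] C Cne by (intro infdist_pos_not_in_closed) auto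
        obtain N :: nat where N: "1 / infdist (cos_sin x) C < N" using reals_Archimedean2 by blast
        have "g n (cos_sin x) = 1" if "n \<ge> N" for n
        proof -
          have "1 / infdist (cos_sin x) C \<le> real n" using N that by linarith
          then have "1 \<le> real n * infdist (cos_sin x) C" using pos by (simp add: pos_divide_le_eq)
          then show ?thesis by (simp add: g_def)
        qed
        then show ?thesis using True
          by (intro tendsto_eventually eventually_sequentiallyI[of N]) auto
      next
        case False
        then have "infdist (cos_sin x) C = 0" using inC[OF x] by simp
        then show ?thesis using False by (simp add: g_def)
      qed
      then show "(\<lambda>n. f x * g n (cos_sin x)) \<longlonglongrightarrow> f x * indicator U x"
        by (rule tendsto_mult_left)
    qed
    show "AE x in torus. norm (f x * g n (cos_sin x)) \<le> \<bar>f x\<bar>" for n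
      by (rule AE_I2) (auto simp: g_def abs_mult infdist_nonneg intro!: mult_left_le)
    show "(\<lambda>x. f x * g n (cos_sin x)) \<in> borel_measurable torus" for n
      by (intro borel_measurable_times L2_measurable[OF f] borel_measurable_integrable
          continuous_integrable_torus continuous_on_compose2[OF cg continuous_cos_sin]) auto
    have "U \<inter> space torus \<in> sets torus"
      using U by (simp add: torus_def sets_restrict_space_iff)
    then show "(\<lambda>x. f x * indicator U x) \<in> borel_measurable torus"
      by (intro borel_measurable_times L2_measurable[OF f] borel_measurable_indicator')
         (simp add: Int_def conj_commute)
  qed (use fint in auto)
  then show ?thesis by (simp add: cont[OF cg] LIMSEQ_const_iff)
qed

text \<open>Up to a null set a measurable set is a countable intersection of open sets. So f has
  integral zero over every measurable set and, as a density, agrees with the zero function.\<close>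

lemma waves_complete:
  assumes f: "f \<in> L2" and orth: "\<And>k c. k \<in> frequencies \<Longrightarrow> l2_inner f (wave k c) = 0"
  shows "AE x in torus. f x = (0::real)"
proof -
  have fint: "integrable torus f"
    using integrable_inner_L2[OF f L2_const[of 1]] by simp
  have "(\<integral>x\<in>A. f x \<partial>torus) = 0" if "A \<in> sets torus" for A
  proof -
    have "A \<in> sets lebesgue" using that by (auto simp: torus_def sets_restrict_space)
    then obtain C N where C: "gdelta C" and N: "N \<in> null_sets lebesgue" "A \<union> N = C"
      using lebesgue_set_almost_gdelta by metis
    from C obtain F :: "nat \<Rightarrow> R3 set" where F: "\<And>n. open (F n)" "C = (\<Inter>n. F n)"
      by (auto elim: gdelta.cases)
    \<comment> \<open>Finite intersections remain open and make the sequence decreasing, so the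
      indicators converge pointwise.\<close>
    define U where "U n = (\<Inter>i\<le>n. F i)" for n
    have U: "open (U n)" for n using F by (auto simp: U_def)
    have mU: "V \<inter> space torus \<in> sets torus" if "open V" for V
      using that by (simp add: torus_def sets_restrict_space_iff)
    have "(\<lambda>n. LINT x|torus. f x * indicator (U n) x) \<longlonglongrightarrow> (LINT x|torus. f x * indicator A x)"
    proof (rule integral_dominated_convergence[where w = "\<lambda>x. \<bar>f x\<bar>"])
      have "AE x in torus. x \<notin> N" by (rule AE_torusI[OF AE_not_in[OF N(1)]])
      then show "AE x in torus. (\<lambda>n. f x * indicator (U n) x) \<longlonglongrightarrow> f x * indicator A x"
      proof (rule AE_mp, intro AE_I2 impI)
        fix x assume "x \<notin> N"
        have "(\<lambda>n. indicator (U n) x) \<longlonglongrightarrow> (indicator A x :: real)"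
        proof (cases "x \<in> A")
          case True
          then have "x \<in> U n" for n using N(2) F(2) by (auto simp: U_def)
          with True show ?thesis by simp
        next
          case False
          then obtain m where "x \<notin> F m" using \<open>x \<notin> N\<close> N(2) F(2) by auto
          then have "x \<notin> U n" if "n \<ge> m" for n using that by (auto simp: U_def)
          then show ?thesis using False
            by (intro tendsto_eventually eventually_sequentiallyI[of m]) auto
        qed
        then show "(\<lambda>n. f x * indicator (U n) x) \<longlonglongrightarrow> f x * indicator A x"
          by (rule tendsto_mult_left)
      qed
      show "AE x in torus. norm (f x * indicator (U n) x) \<le> \<bar>f x\<bar>" for n
        by (rule AE_I2) (auto simp: indicator_def)
      show "(\<lambda>x. f x * indicator (U n) x) \<in> borel_measurable torus" for n
        using mU[OF U[of n]]
        by (intro borel_measurable_times L2_measurable[OF f] borel_measurable_indicator')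
           (simp add: Int_def conj_commute)
      show "(\<lambda>x. f x * indicator A x) \<in> borel_measurable torus"
        using that by (intro borel_measurable_times L2_measurable[OF f] borel_measurable_indicator)
    qed (use fint in auto)
    then show ?thesis
      by (simp add: integral_indicator_open_zero[OF f orth U] LIMSEQ_const_iff
          set_lebesgue_integral_def mult.commute)
  qed
  then show ?thesis
    using density_unique_real[OF fint, of "\<lambda>x. 0"] by (simp add: set_lebesgue_integral_def)
qed

section \<open>Weak gradients\<close>

lemma integral_by_parts:
  fixes f g :: "R3 \<Rightarrow> real"
  assumes "smooth_torus f" "smooth_torus g"
  shows "(LINT x|torus. f x * partial i g x) = - (LINT x|torus. partial i f x * g x)"
proof -
  have "integrable torus (\<lambda>x. f x * partial i g x)" "integrable torus (\<lambda>x. partial i f x * g x)"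
    using assms by (intro continuous_integrable_torus smooth_torus_continuous smooth_torus_mult smooth_torus_partial; simp)+
  then show ?thesis
    using integral_partial_zero[OF smooth_torus_mult[OF assms], of i] by (simp add: partial_mult assms)
qed

lemma L2_integrable:
  assumes "f \<in> L2"
  shows "integrable torus f"
  using integrable_inner_L2[OF L2_norm[OF assms] L2_const[of 1]] L2_measurable[OF assms]
  by (simp add: integrable_norm_iff)

lemma L2_times:
  fixes f :: "R3 \<Rightarrow> 'b::euclidean_space"
  assumes f: "f \<in> L2" and g: "continuous_on UNIV g" "periodic g"
  shows "(\<lambda>x. (g x :: real) *\<^sub>R f x) \<in> L2"
proof -
  have "bounded (g ` cbox 0 (\<chi> i. 2 * pi))"
    by (intro compact_imp_bounded compact_continuous_image continuous_on_subset[OF g(1)]) auto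
  then obtain M where M: "\<And>x. x \<in> cbox 0 (\<chi> i. 2 * pi) \<Longrightarrow> \<bar>g x\<bar> \<le> M"
    by (auto simp: bounded_iff)
  show ?thesis
  proof (rule L2_comp_bound[OF f, where c = M])
    show "(\<lambda>x. g x *\<^sub>R f x) \<in> borel_measurable torus"
      by (intro borel_measurable_scaleR L2_measurable[OF f]
          borel_measurable_integrable continuous_integrable_torus g)
    show "periodic (\<lambda>x. g x *\<^sub>R f x)"
      using L2_periodic[OF f] g(2) by (simp add: periodic_def)
    show "norm (g x *\<^sub>R f x) \<le> M * norm (f x)" if "x \<in> cbox 0 (\<chi> i. 2 * pi)" for x
      using M[OF that] by (simp add: mult_right_mono)
  qed
qed

lemma L2_times_smooth:
  fixes f :: "R3 \<Rightarrow> 'b::euclidean_space"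
  shows "f \<in> L2 \<Longrightarrow> smooth_torus g \<Longrightarrow> (\<lambda>x. (g x :: real) *\<^sub>R f x) \<in> L2"
  by (intro L2_times smooth_torus_continuous smooth_torus_periodic)

lemma L2_smooth_scaleR:
  fixes e :: "'b::euclidean_space"
  shows "smooth_torus g \<Longrightarrow> (\<lambda>x. (g x :: real) *\<^sub>R e) \<in> L2"
  by (rule L2_times_smooth[OF L2_const])

lemma smooth_torus_scaleR: "smooth_torus g \<Longrightarrow> smooth_torus (\<lambda>x. (g x :: real) *\<^sub>R e)"
  by (rule smooth_torus_bounded_linear[OF _ bounded_linear_scaleR_left])

lemma partial_scaleR: "smooth_torus g \<Longrightarrow> partial i (\<lambda>x. (g x :: real) *\<^sub>R e) x = partial i g x *\<^sub>R e"
  by (rule partial_bounded_linear[OF _ bounded_linear_scaleR_left])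

lemma grad_nth: "grad f x $ i = partial i f x"
  by (simp add: grad_def)

lemma grad_L2:
  fixes f :: "R3 \<Rightarrow> 'b::euclidean_space"
  shows "smooth_torus f \<Longrightarrow> grad f \<in> L2"
  unfolding grad_def[abs_def] by (intro L2_vec smooth_torus_L2 smooth_torus_partial)

text \<open>Pairing with a fixed vector e turns the vector-valued identity into an orthogonality
  relation for the pair (f, G). In this form weak differentiability is accessible to Hilbert space
  arguments.\<close>

lemma has_weak_grad_iff:
  assumes f: "f \<in> L2" and G: "G \<in> L2"
  shows "has_weak_grad f G \<longleftrightarrow> (\<forall>\<theta> i e. smooth_torus \<theta> \<longrightarrow>
    l2_inner (\<lambda>x. partial i \<theta> x *\<^sub>R e) f + l2_inner (\<lambda>x. \<theta> x *\<^sub>R e) (\<lambda>x. G x $ i) = 0)"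
proof -
  have eq: "l2_inner (\<lambda>x. g x *\<^sub>R e) h = e \<bullet> (LINT x|torus. g x *\<^sub>R h x)"
    if "h \<in> L2" "smooth_torus g" for g and h :: "R3 \<Rightarrow> R3" and e
  proof -
    have "(\<lambda>x. g x *\<^sub>R h x) \<in> L2" by (intro L2_times_smooth that)
    then have "integrable torus (\<lambda>x. g x *\<^sub>R h x)" by (rule L2_integrable)
    then show ?thesis
      by (simp add: l2_inner_def flip: integral_inner_right)
  qed
  have "(a = - b) \<longleftrightarrow> (\<forall>e. e \<bullet> a + e \<bullet> b = 0)" for a b :: R3
    by (metis add_eq_0_iff2 inner_add_right inner_eq_zero_iff inner_zero_right)
  then show ?thesis
    unfolding has_weak_grad_def using f G
    by (simp add: eq L2_nth smooth_torus_partial)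
qed

lemma has_weak_gradD:
  assumes "has_weak_grad f G" "f \<in> L2" "G \<in> L2" "smooth_torus \<theta>"
  shows "l2_inner (\<lambda>x. partial i \<theta> x *\<^sub>R e) f + l2_inner (\<lambda>x. \<theta> x *\<^sub>R e) (\<lambda>x. G x $ i) = 0"
  using assms has_weak_grad_iff by blast

lemma has_weak_grad_smooth:
  assumes f: "smooth_torus f"
  shows "has_weak_grad f (grad f)"
  unfolding has_weak_grad_iff[OF smooth_torus_L2[OF f] grad_L2[OF f]]
proof (intro allI impI)
  fix \<theta> :: "R3 \<Rightarrow> real" and i and e :: R3
  assume \<theta>: "smooth_torus \<theta>"
  have "smooth_torus (\<lambda>x. e \<bullet> f x)" "\<And>x. partial i (\<lambda>x. e \<bullet> f x) x = e \<bullet> partial i f x"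
    by (rule smooth_torus_bounded_linear[OF f bounded_linear_inner_right])
       (rule partial_bounded_linear[OF f bounded_linear_inner_right])
  then show "l2_inner (\<lambda>x. partial i \<theta> x *\<^sub>R e) f + l2_inner (\<lambda>x. \<theta> x *\<^sub>R e) (\<lambda>x. grad f x $ i) = 0"
    using integral_by_parts[OF \<theta>, of "\<lambda>x. e \<bullet> f x" i] by (simp add: l2_inner_def grad_nth)
qed

lemma has_weak_grad_diff:
  assumes "has_weak_grad f F" "has_weak_grad g G" "f \<in> L2" "g \<in> L2" "F \<in> L2" "G \<in> L2"
  shows "has_weak_grad (\<lambda>x. f x - g x) (\<lambda>x. F x - G x)"
  unfolding has_weak_grad_iff[OF L2_diff[OF assms(3,4)] L2_diff[OF assms(5,6)]]
proof (intro allI impI)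
  fix \<theta> :: "R3 \<Rightarrow> real" and i and e :: R3
  assume \<theta>: "smooth_torus \<theta>"
  note memb = L2_smooth_scaleR[OF \<theta>, of e] L2_smooth_scaleR[OF smooth_torus_partial[OF \<theta>], of i e]
  show "l2_inner (\<lambda>x. partial i \<theta> x *\<^sub>R e) (\<lambda>x. f x - g x) +
      l2_inner (\<lambda>x. \<theta> x *\<^sub>R e) (\<lambda>x. (F x - G x) $ i) = 0"
    using has_weak_gradD[OF assms(1,3,5) \<theta>, of i e] has_weak_gradD[OF assms(2,4,6) \<theta>, of i e] memb assms
    by (simp add: l2_inner_diff_right L2_nth)
qed

lemma wave_shift: "wave k (c + pi) x = - wave k c x"
  using cos_periodic_pi[of "k \<bullet> x + c"] by (simp add: wave_def add.assoc)

lemma partial_wave_scaleR: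
  "k \<in> frequencies \<Longrightarrow> partial i (\<lambda>x. wave k c x *\<^sub>R e) x = (k $ i * wave k (c + pi / 2) x) *\<^sub>R e"
  by (simp add: partial_scaleR smooth_torus_wave partial_wave)

lemma wave_field_L2:
  fixes e :: "'b::euclidean_space"
  shows "k \<in> frequencies \<Longrightarrow> (\<lambda>x. wave k c x *\<^sub>R e) \<in> L2"
  by (intro L2_smooth_scaleR smooth_torus_wave)

text \<open>Differentiation as a Fourier multiplier in real form: the imaginary unit appears as the
  quarter-period phase shift.\<close>

lemma has_weak_grad_wave:
  assumes "has_weak_grad f G" "f \<in> L2" "G \<in> L2" "k \<in> frequencies"
  shows "l2_inner (\<lambda>x. G x $ i) (\<lambda>x. wave k c x *\<^sub>R e) = - (k $ i) * l2_inner f (\<lambda>x. wave k (c + pi / 2) x *\<^sub>R e)"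
proof -
  have "l2_inner (\<lambda>x. partial i (wave k c) x *\<^sub>R e) f = k $ i * l2_inner f (\<lambda>x. wave k (c + pi / 2) x *\<^sub>R e)"
    using l2_inner_scaleR(2)[of f "k $ i" "\<lambda>x. wave k (c + pi / 2) x *\<^sub>R e"]
    by (simp add: partial_wave l2_inner_commute[of _ f])
  then show ?thesis
    using has_weak_gradD[OF assms(1-3) smooth_torus_wave[OF assms(4)], of i c e]
    by (simp add: l2_inner_commute[of _ "\<lambda>x. G x $ i"])
qed

lemma wave_fields_complete:
  fixes f :: "R3 \<Rightarrow> R3"
  assumes f: "f \<in> L2" and orth: "\<And>k c e. k \<in> frequencies \<Longrightarrow> l2_inner f (\<lambda>x. wave k c x *\<^sub>R e) = 0"
  shows "AE x in torus. f x = 0"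
proof -
  have "AE x in torus. f x $ j = 0" for j
  proof (rule waves_complete[OF L2_nth[OF f]])
    show "l2_inner (\<lambda>x. f x $ j) (wave k c) = 0" if "k \<in> frequencies" for k c
      using orth[OF that, of c "axis j 1"] by (simp add: l2_inner_def inner_axis mult.commute)
  qed
  then have "AE x in torus. \<forall>j\<in>UNIV. f x $ j = 0" by (subst AE_ball_countable) auto
  then show ?thesis by (simp add: vec_eq_iff)
qed

text \<open>The Fourier coefficients of a weak gradient are determined by those of the function.
  Since \<open>weak_grad\<close> is a mere choice, this is what allows an explicit gradient to take
  its place almost everywhere.\<close>

lemma has_weak_grad_unique:
  assumes "has_weak_grad f F" "has_weak_grad g G" "f \<in> L2" "g \<in> L2" "F \<in> L2" "G \<in> L2"
    and "AE x in torus. f x = g x"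
  shows "AE x in torus. F x = G x"
proof -
  have "AE x in torus. F x $ i - G x $ i = 0" for i
  proof (rule wave_fields_complete[OF L2_diff[OF L2_nth[OF assms(5)] L2_nth[OF assms(6)]]])
    fix k c and e :: R3
    assume k: "k \<in> frequencies"
    have "l2_inner f (\<lambda>x. wave k (c + pi / 2) x *\<^sub>R e) = l2_inner g (\<lambda>x. wave k (c + pi / 2) x *\<^sub>R e)"
      by (rule l2_inner_cong_AE[OF assms(7)]) (use assms k wave_field_L2 in auto)
    then show "l2_inner (\<lambda>x. F x $ i - G x $ i) (\<lambda>x. wave k c x *\<^sub>R e) = 0"
      using has_weak_grad_wave[OF assms(1,3,5) k, of i c e] has_weak_grad_wave[OF assms(2,4,6) k, of i c e]
      by (simp add: l2_inner_diff_left L2_nth assms wave_field_L2 k)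
  qed
  then have "AE x in torus. \<forall>i\<in>UNIV. F x $ i - G x $ i = 0" by (subst AE_ball_countable) auto
  then show ?thesis by (simp add: vec_eq_iff)
qed

text \<open>The L^2 inner product of such pairs is the H^1 inner product of the fields, so H^1
  orthogonality needs no separate Hilbert space.\<close>

definition wave_jets :: "(R3 \<Rightarrow> R3 \<times> (R3 ^ 3)) set" where
  "wave_jets = {\<lambda>x. (wave k c x *\<^sub>R e, grad (\<lambda>x. wave k c x *\<^sub>R e) x) | k c e. k \<in> frequencies}"

lemma wave_jet_grad_L2: "k \<in> frequencies \<Longrightarrow> grad (\<lambda>x. wave k c x *\<^sub>R (e :: R3)) \<in> L2"
  by (intro grad_L2 smooth_torus_scaleR smooth_torus_wave)

lemma wave_jets_L2: "wave_jets \<subseteq> L2"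
  by (auto simp: wave_jets_def intro!: L2_Pair wave_field_L2 wave_jet_grad_L2)

lemma L2_axis:
  assumes "f \<in> L2"
  shows "(\<lambda>x. axis i (f x) :: 'b::euclidean_space ^ 'n::finite) \<in> L2"
proof -
  have "(\<lambda>x. if j = i then f x else 0) \<in> L2" for j
    using assms by (cases "j = i") (simp_all add: L2_const)
  then show ?thesis
    unfolding axis_def by (rule L2_vec)
qed

lemma l2_inner_axis_right: "l2_inner g (\<lambda>x. axis i (f x)) = l2_inner (\<lambda>x. g x $ i) f"
  by (simp add: l2_inner_def inner_axis)

lemma l2_inner_axis_left: "l2_inner (\<lambda>x. axis i (f x)) g = l2_inner f (\<lambda>x. g x $ i)"
  unfolding l2_inner_commute[of _ g] l2_inner_axis_right by (rule l2_inner_commute)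

text \<open>Weak derivatives are detected by the trigonometric fields alone: the remainder of the
  \<open>H\<^sup>1\<close>-jet of \<open>f\<close> after projection onto the closed span of the trigonometric jets is again the jet
  of some \<open>r\<close>, and testing it with a wave of frequency \<open>k\<close> gives \<open>(1 + \<bar>k\<bar>\<^sup>2)\<close> times a Fourier
  coefficient of \<open>r\<close>.\<close>

lemma orthogonal_wave_jets:
  assumes H: "H \<in> orthogonal_complement wave_jets"
    and fG: "f \<in> L2" "G \<in> L2" "has_weak_grad f G"
  shows "l2_inner H (\<lambda>x. (f x, G x)) = 0"
proof -
  define W where "W = orthogonal_complement wave_jets"
  define V where "V = orthogonal_complement W"
  define F where "F x = (f x, G x)" for x
  have F: "F \<in> L2" unfolding F_def by (rule L2_Pair[OF fG(1,2)])
  have WL2: "W \<subseteq> L2" by (auto simp: W_def orthogonal_complement_def)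
  have HL2: "H \<in> L2" using H by (simp add: orthogonal_complement_def)
  obtain g where gV: "g \<in> V" and g: "\<And>z. z \<in> V \<Longrightarrow> l2_inner (\<lambda>x. F x - g x) z = 0"
    using projection_exists[OF WL2 F] unfolding V_def by blast
  have gL2: "g \<in> L2" using gV by (simp add: V_def orthogonal_complement_def)
  define g1 g2 where "g1 x = fst (g x)" and "g2 x = snd (g x)" for x
  have g12: "g = (\<lambda>x. (g1 x, g2 x))" by (simp add: g1_def g2_def fun_eq_iff)
  have g1: "g1 \<in> L2" and g2: "g2 \<in> L2"
    unfolding g1_def[abs_def] g2_def[abs_def]
    by (rule L2_bounded_linear[OF gL2 bounded_linear_fst]) (rule L2_bounded_linear[OF gL2 bounded_linear_snd])
  have jets: "wave_jets \<subseteq> V"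
    using wave_jets_L2 by (auto simp: V_def W_def orthogonal_complement_def l2_inner_commute)
  have "has_weak_grad g1 g2"
    unfolding has_weak_grad_iff[OF g1 g2]
  proof (intro allI impI)
    fix \<theta> :: "R3 \<Rightarrow> real" and i and e :: R3
    assume \<theta>: "smooth_torus \<theta>"
    note memb = L2_smooth_scaleR[OF \<theta>, of e] L2_smooth_scaleR[OF smooth_torus_partial[OF \<theta>], of i e]
    \<comment> \<open>Chosen so that orthogonality of (a, b) to h is the weak gradient identity for
      b tested with \<theta> e. Wave jets satisfy it, so h lies in W and is orthogonal to g; thus
      the projection is again a jet.\<close>
    define h where "h x = (partial i \<theta> x *\<^sub>R e, axis i (\<theta> x *\<^sub>R e) :: R3 ^ 3)" for x
    have inner_h: "l2_inner h (\<lambda>x. (a x, b x)) =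
        l2_inner (\<lambda>x. partial i \<theta> x *\<^sub>R e) a + l2_inner (\<lambda>x. \<theta> x *\<^sub>R e) (\<lambda>x. b x $ i)"
      if "a \<in> L2" "b \<in> L2" for a b
      unfolding h_def using that memb by (simp add: l2_inner_Pair L2_axis l2_inner_axis_left)
    have "h \<in> W"
      unfolding W_def orthogonal_complement_def
    proof (intro CollectI conjI ballI)
      show "h \<in> L2" unfolding h_def by (intro L2_Pair L2_axis memb)
      fix J assume "J \<in> wave_jets"
      then obtain k c d where J: "J = (\<lambda>x. (wave k c x *\<^sub>R d, grad (\<lambda>x. wave k c x *\<^sub>R d) x))"
        and k: "k \<in> frequencies" by (auto simp: wave_jets_def)
      show "l2_inner h J = 0"
        unfolding J inner_h[OF wave_field_L2[OF k] wave_jet_grad_L2[OF k]]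
        by (intro has_weak_gradD has_weak_grad_smooth smooth_torus_scaleR smooth_torus_wave k wave_field_L2
            wave_jet_grad_L2 \<theta>)
    qed
    then have "l2_inner h g = 0"
      using gV by (auto simp: V_def orthogonal_complement_def l2_inner_commute)
    then show "l2_inner (\<lambda>x. partial i \<theta> x *\<^sub>R e) g1 + l2_inner (\<lambda>x. \<theta> x *\<^sub>R e) (\<lambda>x. g2 x $ i) = 0"
      using inner_h[OF g1 g2] by (simp add: g12)
  qed
  define r r2 where "r x = f x - g1 x" and "r2 x = G x - g2 x" for x
  have r: "r \<in> L2" "r2 \<in> L2" "has_weak_grad r r2"
    unfolding r_def[abs_def] r2_def[abs_def]
    by (intro L2_diff fG g1 g2 has_weak_grad_diff \<open>has_weak_grad g1 g2\<close>)+
  have "AE x in torus. r x = 0"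
  proof (rule wave_fields_complete[OF r(1)])
    fix k c and e :: R3
    assume k: "k \<in> frequencies"
    let ?w = "\<lambda>x. wave k c x *\<^sub>R e"
    have "(\<lambda>x. (?w x, grad ?w x)) \<in> wave_jets" using k by (auto simp: wave_jets_def)
    then have "l2_inner (\<lambda>x. F x - g x) (\<lambda>x. (?w x, grad ?w x)) = 0"
      using g jets by blast
    moreover have "(\<lambda>x. F x - g x) = (\<lambda>x. (r x, r2 x))"
      by (simp add: F_def g12 r_def r2_def)
    ultimately have "l2_inner r ?w + l2_inner r2 (grad ?w) = 0"
      using l2_inner_Pair[OF r(1,2) wave_field_L2[OF k] wave_jet_grad_L2[OF k]] by simp
    \<comment> \<open>The phase advances by a quarter period twice, once in the classical derivative
      of the wave and once in the weak derivative of r. The resulting half period reverses the sign,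
      so each direction contributes a nonnegative factor.\<close>
    moreover have "l2_inner r2 (grad ?w) = (k \<bullet> k) * l2_inner r ?w"
    proof -
      have "l2_inner (\<lambda>x. r2 x $ i) (\<lambda>x. grad ?w x $ i) = (k $ i * k $ i) * l2_inner r ?w" for i
      proof -
        have "(\<lambda>x. grad ?w x $ i) = (\<lambda>x. (k $ i) *\<^sub>R (wave k (c + pi / 2) x *\<^sub>R e))"
          by (simp add: grad_nth partial_wave_scaleR k)
        then have "l2_inner (\<lambda>x. r2 x $ i) (\<lambda>x. grad ?w x $ i)
            = k $ i * l2_inner (\<lambda>x. r2 x $ i) (\<lambda>x. wave k (c + pi / 2) x *\<^sub>R e)"
          by (simp only: l2_inner_scaleR)
        also have "\<dots> = - (k $ i * k $ i) * l2_inner r (\<lambda>x. wave k (c + pi / 2 + pi / 2) x *\<^sub>R e)"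
          by (simp only: has_weak_grad_wave[OF r(3,1,2) k]) simp
        also have "(\<lambda>x. wave k (c + pi / 2 + pi / 2) x *\<^sub>R e) = (\<lambda>x. (- 1) *\<^sub>R ?w x)"
          by (simp add: add.assoc wave_shift)
        finally show ?thesis by (simp only: l2_inner_scaleR) simp
      qed
      then show ?thesis
        by (simp add: l2_inner_vec[OF r(2) wave_jet_grad_L2[OF k]] inner_vec_def sum_distrib_right)
    qed
    ultimately have "(1 + k \<bullet> k) * l2_inner r ?w = 0" by (simp add: distrib_right)
    moreover have "1 + k \<bullet> k > 0" by (simp add: add_pos_nonneg)
    ultimately show "l2_inner r ?w = 0" by simp
  qed
  then have AE1: "AE x in torus. f x = g1 x" by (simp add: r_def)
  then have "AE x in torus. G x = g2 x"
    by (rule has_weak_grad_unique[OF fG(3) \<open>has_weak_grad g1 g2\<close> fG(1) g1 fG(2) g2])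
  with AE1 have "AE x in torus. F x = g x"
    unfolding F_def g12 by eventually_elim simp
  \<comment> \<open>F now equals its projection, which lies in V, while H lies in W.\<close>
  then have "l2_inner H F = l2_inner H g"
    by (intro l2_inner_cong_AE HL2 F gL2) auto
  also have "\<dots> = 0"
    using gV H unfolding V_def W_def by (subst l2_inner_commute) (simp add: orthogonal_complement_def)
  finally show ?thesis by (simp add: F_def[abs_def])
qed

section \<open>The Leray projection and weak derivatives\<close>

lemma L2_sigma_eq: "L2_sigma = orthogonal_complement (grad ` {\<theta> :: R3 \<Rightarrow> real. smooth_torus \<theta>})"
  by (auto simp: L2_sigma_def orthogonal_complement_def)

lemma L2_sigma_L2: "v \<in> L2_sigma \<Longrightarrow> v \<in> L2"
  by (simp add: L2_sigma_def)

lemma L2_sigma_diff: "u \<in> L2_sigma \<Longrightarrow> v \<in> L2_sigma \<Longrightarrow> (\<lambda>x. u x - v x) \<in> L2_sigma"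
  by (simp add: L2_sigma_def L2_diff l2_inner_diff_left grad_L2)

lemma leray_properties:
  assumes "f \<in> L2"
  shows leray_L2_sigma: "leray f \<in> L2_sigma"
    and leray_orthogonal: "z \<in> L2_sigma \<Longrightarrow> l2_inner (\<lambda>x. f x - leray f x) z = 0"
proof -
  have "grad ` {\<theta> :: R3 \<Rightarrow> real. smooth_torus \<theta>} \<subseteq> L2" by (auto intro!: grad_L2)
  from projection_exists[OF this assms]
  have "\<exists>g. g \<in> L2_sigma \<and> (\<forall>z\<in>L2_sigma. l2_inner (\<lambda>x. f x - g x) z = 0)"
    unfolding L2_sigma_eq by blast
  from someI_ex[OF this] show "leray f \<in> L2_sigma"
    "z \<in> L2_sigma \<Longrightarrow> l2_inner (\<lambda>x. f x - leray f x) z = 0"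
    by (auto simp: leray_def)
qed

lemma leray_L2: "f \<in> L2 \<Longrightarrow> leray f \<in> L2"
  by (rule L2_sigma_L2[OF leray_L2_sigma])

lemma leray_inner: "f \<in> L2 \<Longrightarrow> z \<in> L2_sigma \<Longrightarrow> l2_inner (leray f) z = l2_inner f z"
  using leray_orthogonal[of f z] by (simp add: l2_inner_diff_left leray_L2 L2_sigma_L2)

text \<open>The difference of two candidates lies in \<open>L2_sigma\<close> and is orthogonal to
  it, hence to itself. Idempotence and additivity of the chosen representative are read off from
  this.\<close>

lemma leray_unique:
  assumes f: "f \<in> L2" and g: "g \<in> L2_sigma" and eq: "\<And>z. z \<in> L2_sigma \<Longrightarrow> l2_inner g z = l2_inner f z"
  shows "AE x in torus. g x = leray f x"
proof -
  let ?d = "\<lambda>x. g x - leray f x"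
  have d: "?d \<in> L2_sigma" by (intro L2_sigma_diff g leray_L2_sigma f)
  have "l2_inner ?d ?d = 0"
    using eq[OF d] leray_inner[OF f d]
    by (simp add: l2_inner_diff_left[OF L2_sigma_L2[OF g] leray_L2[OF f] L2_sigma_L2[OF d]])
  from l2_inner_self_eq_0[OF L2_sigma_L2[OF d] this] show ?thesis by simp
qed

lemma leray_fixed: "f \<in> L2_sigma \<Longrightarrow> AE x in torus. f x = leray f x"
  by (rule leray_unique) (auto intro: L2_sigma_L2)

lemma leray_diff:
  assumes "f \<in> L2" "g \<in> L2"
  shows "AE x in torus. leray f x - leray g x = leray (\<lambda>x. f x - g x) x"
proof (rule leray_unique[OF L2_diff[OF assms]])
  show "(\<lambda>x. leray f x - leray g x) \<in> L2_sigma"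
    by (intro L2_sigma_diff leray_L2_sigma assms)
  show "l2_inner (\<lambda>x. leray f x - leray g x) z = l2_inner (\<lambda>x. f x - g x) z" if "z \<in> L2_sigma" for z
    using that assms by (simp add: l2_inner_diff_left leray_L2 L2_sigma_L2 leray_inner)
qed

lemma leray_norm_le:
  assumes f: "f \<in> L2"
  shows "l2_norm (leray f) \<le> l2_norm f"
proof (cases "l2_norm (leray f) = 0")
  case False
  have "l2_norm (leray f) * l2_norm (leray f) = l2_inner f (leray f)"
    using leray_inner[OF f leray_L2_sigma[OF f]] l2_norm_square[of "leray f"] by (simp add: power2_eq_square)
  also have "\<dots> \<le> l2_norm f * l2_norm (leray f)"
    using l2_Cauchy_Schwarz[OF f leray_L2[OF f]] by simp
  finally show ?thesis
    using False l2_norm_nonneg[of "leray f"] by (simp add: mult_le_cancel_right)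
qed (simp add: l2_norm_nonneg)

lemma l2_norm_cong_AE:
  "AE x in torus. f x = g x \<Longrightarrow> f \<in> L2 \<Longrightarrow> g \<in> L2 \<Longrightarrow> l2_norm f = l2_norm g"
  unfolding l2_norm_def by (simp only: l2_inner_cong_AE)

lemma leray_norm_diff_le:
  assumes "f \<in> L2" "g \<in> L2"
  shows "l2_norm (\<lambda>x. leray f x - leray g x) \<le> l2_norm (\<lambda>x. f x - g x)"
  using leray_norm_le[OF L2_diff[OF assms]]
    l2_norm_cong_AE[OF leray_diff[OF assms] L2_diff[OF leray_L2 leray_L2] leray_L2[OF L2_diff]] assms
  by simp

lemma divergence_free_L2_sigma:
  assumes \<psi>: "smooth_torus \<psi>" and div: "\<And>x. divergence \<psi> x = 0"
  shows "\<psi> \<in> L2_sigma"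
proof -
  have "l2_inner \<psi> (grad \<theta>) = 0" if \<theta>: "smooth_torus \<theta>" for \<theta> :: "R3 \<Rightarrow> real"
  proof -
    have "l2_inner \<psi> (grad \<theta>) = (\<Sum>i\<in>UNIV. LINT x|torus. \<psi> x $ i * partial i \<theta> x)"
      using l2_inner_vec[OF smooth_torus_L2[OF \<psi>] grad_L2[OF \<theta>]] by (simp add: l2_inner_def grad_nth)
    also have "\<dots> = - (\<Sum>i\<in>UNIV. LINT x|torus. partial i \<psi> x $ i * \<theta> x)"
      using integral_by_parts[OF smooth_torus_nth[OF \<psi>] \<theta>] by (simp add: partial_nth[OF \<psi>] sum_negf)
    also have "(\<Sum>i\<in>UNIV. LINT x|torus. partial i \<psi> x $ i * \<theta> x) = (LINT x|torus. (\<Sum>i\<in>UNIV. partial i \<psi> x $ i * \<theta> x))"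
      by (intro Bochner_Integration.integral_sum[symmetric] continuous_integrable_torus smooth_torus_continuous smooth_torus_mult
          smooth_torus_nth smooth_torus_partial \<psi> \<theta>)
    also have "\<dots> = 0"
      using div by (simp add: divergence_def flip: sum_distrib_right)
    finally show ?thesis by simp
  qed
  then show ?thesis by (simp add: L2_sigma_def smooth_torus_L2[OF \<psi>])
qed

lemma wave_field_L2_sigma:
  assumes k: "k \<in> frequencies" and e: "k \<bullet> e = 0"
  shows "(\<lambda>x. wave k c x *\<^sub>R e) \<in> L2_sigma"
proof (rule divergence_free_L2_sigma[OF smooth_torus_scaleR[OF smooth_torus_wave[OF k]]])
  fix x
  have "divergence (\<lambda>x. wave k c x *\<^sub>R e) x = wave k (c + pi / 2) x * (k \<bullet> e)"
    by (simp add: divergence_def partial_wave_scaleR k inner_vec_def sum_distrib_left sum_distrib_right mult_ac)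
  then show "divergence (\<lambda>x. wave k c x *\<^sub>R e) x = 0" using e by simp
qed

lemma L2_sigma_wave_gradient:
  assumes "v \<in> L2_sigma" and k: "k \<in> frequencies"
  shows "l2_inner v (\<lambda>x. wave k c x *\<^sub>R k) = 0"
proof -
  \<comment> \<open>Retarding the phase by a quarter period compensates the advance caused by
    differentiation: longitudinal waves are gradients.\<close>
  have "grad (wave k (c - pi / 2)) = (\<lambda>x. wave k c x *\<^sub>R k)"
    by (simp add: fun_eq_iff vec_eq_iff grad_nth partial_wave mult.commute)
  then show ?thesis
    using assms smooth_torus_wave[OF k, of "c - pi / 2"] by (auto simp: L2_sigma_def)
qed

text \<open>On waves the projection acts by the matrix I - k k^T / |k|^2: the transversal part of e
  gives a divergence-free field, the longitudinal part a gradient. At k = 0 the correction term is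
  zero, as it should be, since constant fields are divergence free.\<close>

lemma leray_wave:
  assumes f: "f \<in> L2" and k: "k \<in> frequencies"
  shows "l2_inner (leray f) (\<lambda>x. wave k c x *\<^sub>R e) = l2_inner f (\<lambda>x. wave k c x *\<^sub>R (e - (k \<bullet> e / (k \<bullet> k)) *\<^sub>R k))"
proof -
  define a where "a = k \<bullet> e / (k \<bullet> k)"
  have "k \<bullet> (e - a *\<^sub>R k) = 0"
    by (cases "k = 0") (simp_all add: a_def inner_diff_right)
  then have div: "(\<lambda>x. wave k c x *\<^sub>R (e - a *\<^sub>R k)) \<in> L2_sigma"
    by (rule wave_field_L2_sigma[OF k])
  have "(\<lambda>x. wave k c x *\<^sub>R e) = (\<lambda>x. wave k c x *\<^sub>R (e - a *\<^sub>R k) + a *\<^sub>R (wave k c x *\<^sub>R k))"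
    by (simp add: algebra_simps)
  then have "l2_inner (leray f) (\<lambda>x. wave k c x *\<^sub>R e)
      = l2_inner (leray f) (\<lambda>x. wave k c x *\<^sub>R (e - a *\<^sub>R k)) + a * l2_inner (leray f) (\<lambda>x. wave k c x *\<^sub>R k)"
    using l2_inner_add_right[OF wave_field_L2[OF k, of c "e - a *\<^sub>R k"] L2_scaleR[OF wave_field_L2[OF k, of c k], of a] leray_L2[OF f]]
      l2_inner_scaleR(2)[of "leray f" a "\<lambda>x. wave k c x *\<^sub>R k"] by simp
  then show ?thesis
    using L2_sigma_wave_gradient[OF leray_L2_sigma[OF f] k] leray_inner[OF f div]
    by (simp add: a_def)
qed

text \<open>The matrix of the projection depends on k but not on the phase, so it commutes with the
  phase shift and factor by which a derivative acts.\<close>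

lemma leray_has_weak_grad:
  assumes f: "f \<in> L2" and G: "G \<in> L2" and fG: "has_weak_grad f G"
  shows "has_weak_grad (leray f) (\<lambda>x. \<chi> i. leray (\<lambda>y. G y $ i) x)"
proof -
  have Gi: "(\<lambda>y. G y $ i) \<in> L2" for i by (rule L2_nth[OF G])
  have Pf: "leray f \<in> L2" by (rule leray_L2[OF f])
  have PG: "leray (\<lambda>y. G y $ i) \<in> L2" for i by (rule leray_L2[OF Gi])
  have "l2_inner (\<lambda>x. partial i \<theta> x *\<^sub>R e) (leray f) + l2_inner (\<lambda>x. \<theta> x *\<^sub>R e) (leray (\<lambda>y. G y $ i)) = 0"
    if \<theta>: "smooth_torus \<theta>" for \<theta> :: "R3 \<Rightarrow> real" and i and e :: R3
  proof -
    \<comment> \<open>Here the smooth field \<theta> e plays the part of the H^1 field: the weak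
      gradient identity to be shown is the pairing of H with the jet of \<theta> e, so testing H on
      wave jets suffices.\<close>
    define H where "H x = (leray (\<lambda>y. G y $ i) x, axis i (leray f x) :: R3 ^ 3)" for x
    have inner_H: "l2_inner H (\<lambda>x. (a x, b x)) = l2_inner (leray (\<lambda>y. G y $ i)) a + l2_inner (leray f) (\<lambda>x. b x $ i)"
      if "a \<in> L2" "b \<in> L2" for a b
      unfolding H_def using that by (simp add: l2_inner_Pair L2_axis l2_inner_axis_left Pf PG)
    have "H \<in> orthogonal_complement wave_jets"
      unfolding orthogonal_complement_def
    proof (intro CollectI conjI ballI)
      show "H \<in> L2" unfolding H_def by (intro L2_Pair L2_axis Pf PG)
      fix J assume "J \<in> wave_jets"
      then obtain k c d where J: "J = (\<lambda>x. (wave k c x *\<^sub>R d, grad (\<lambda>x. wave k c x *\<^sub>R d) x))"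
        and k: "k \<in> frequencies" by (auto simp: wave_jets_def)
      define d' where "d' = d - (k \<bullet> d / (k \<bullet> k)) *\<^sub>R k"
      have "(\<lambda>x. grad (\<lambda>x. wave k c x *\<^sub>R d) x $ i) = (\<lambda>x. (k $ i) *\<^sub>R (wave k (c + pi / 2) x *\<^sub>R d))"
        by (simp add: grad_nth partial_wave_scaleR k)
      then have "l2_inner H J = l2_inner (leray (\<lambda>y. G y $ i)) (\<lambda>x. wave k c x *\<^sub>R d)
          + k $ i * l2_inner (leray f) (\<lambda>x. wave k (c + pi / 2) x *\<^sub>R d)"
        unfolding J inner_H[OF wave_field_L2[OF k] wave_jet_grad_L2[OF k]] by (simp only: l2_inner_scaleR)
      \<comment> \<open>The same projected direction d' occurs in both terms, so the weak gradient
        identity of f itself cancels them.\<close>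
      also have "\<dots> = l2_inner (\<lambda>y. G y $ i) (\<lambda>x. wave k c x *\<^sub>R d') + k $ i * l2_inner f (\<lambda>x. wave k (c + pi / 2) x *\<^sub>R d')"
        by (simp only: leray_wave[OF f k] leray_wave[OF Gi k] d'_def)
      also have "\<dots> = 0"
        by (simp add: has_weak_grad_wave[OF fG f G k])
      finally show "l2_inner H J = 0" .
    qed
    then have "l2_inner H (\<lambda>x. (\<theta> x *\<^sub>R e, grad (\<lambda>x. \<theta> x *\<^sub>R e) x)) = 0"
      by (rule orthogonal_wave_jets) (intro L2_smooth_scaleR grad_L2 has_weak_grad_smooth smooth_torus_scaleR \<theta>)+
    then show ?thesis
      unfolding inner_H[OF L2_smooth_scaleR[OF \<theta>] grad_L2[OF smooth_torus_scaleR[OF \<theta>]]]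
      by (simp add: grad_nth partial_scaleR[OF \<theta>] l2_inner_commute add.commute)
  qed
  then show ?thesis
    unfolding has_weak_grad_iff[OF Pf L2_vec[OF PG]] by simp
qed

section \<open>The Leray projection on H^1\<close>

lemma weak_grad_properties:
  assumes "f \<in> H1"
  shows weak_grad_L2: "weak_grad f \<in> L2" and has_weak_grad_weak_grad: "has_weak_grad f (weak_grad f)"
proof -
  have "\<exists>G. G \<in> L2 \<and> has_weak_grad f G" using assms by (auto simp: H1_def)
  from someI_ex[OF this] show "weak_grad f \<in> L2" "has_weak_grad f (weak_grad f)"
    by (auto simp: weak_grad_def)
qed

lemma H1_L2: "f \<in> H1 \<Longrightarrow> f \<in> L2"
  by (simp add: H1_def)

lemma H1_I: "f \<in> L2 \<Longrightarrow> G \<in> L2 \<Longrightarrow> has_weak_grad f G \<Longrightarrow> f \<in> H1"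
  by (auto simp: H1_def)

lemma H1_diff:
  assumes "f \<in> H1" "g \<in> H1"
  shows "(\<lambda>x. f x - g x) \<in> H1"
  by (rule H1_I[OF L2_diff L2_diff has_weak_grad_diff[OF has_weak_grad_weak_grad has_weak_grad_weak_grad]])
     (use assms in \<open>simp_all add: H1_L2 weak_grad_L2\<close>)

lemma leray_H1:
  assumes "f \<in> H1"
  shows "leray f \<in> H1"
  using H1_I[OF leray_L2 L2_vec leray_has_weak_grad[OF _ _ has_weak_grad_weak_grad]]
    assms leray_L2[OF L2_nth[OF weak_grad_L2[OF assms]]]
  by (simp add: H1_L2 weak_grad_L2)

lemma weak_grad_leray:
  assumes f: "f \<in> H1"
  shows "AE x in torus. weak_grad (leray f) x = (\<chi> i. leray (\<lambda>y. weak_grad f y $ i) x)"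
proof (rule has_weak_grad_unique)
  show "has_weak_grad (leray f) (\<lambda>x. \<chi> i. leray (\<lambda>y. weak_grad f y $ i) x)"
    by (intro leray_has_weak_grad H1_L2 weak_grad_L2 has_weak_grad_weak_grad f)
qed (use f in \<open>auto intro!: has_weak_grad_weak_grad weak_grad_L2 leray_H1 H1_L2 L2_vec leray_L2 L2_nth\<close>)

lemma h1_norm_eq_l2_norm:
  assumes "f \<in> H1"
  shows "h1_norm f = l2_norm (\<lambda>x. (f x, weak_grad f x))"
  using l2_inner_Pair[OF H1_L2 weak_grad_L2 H1_L2 weak_grad_L2, OF assms assms assms assms]
  by (simp add: h1_norm_def l2_norm_square) (simp add: l2_norm_def)

lemma h1_norm_nonneg: "h1_norm f \<ge> 0"
  by (simp add: h1_norm_def)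

lemma h1_norm_cong_AE:
  assumes "AE x in torus. f x = g x" "f \<in> H1" "g \<in> H1"
  shows "h1_norm f = h1_norm g"
proof -
  have "AE x in torus. weak_grad f x = weak_grad g x"
    using assms by (intro has_weak_grad_unique[of f _ g] has_weak_grad_weak_grad weak_grad_L2 H1_L2)
  then have "l2_norm (weak_grad f) = l2_norm (weak_grad g)"
    using assms by (intro l2_norm_cong_AE weak_grad_L2)
  moreover have "l2_norm f = l2_norm g"
    using assms by (intro l2_norm_cong_AE H1_L2)
  ultimately show ?thesis by (simp add: h1_norm_def)
qed

text \<open>The gradient chosen for f - g is first replaced by the difference of the gradients
  chosen for f and g; what remains is the L^2 inequality for jets. It makes the H^1 norm continuous
  along approximating simple functions.\<close>

lemma h1_norm_reverse_triangle:
  assumes f: "f \<in> H1" and g: "g \<in> H1"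
  shows "\<bar>h1_norm f - h1_norm g\<bar> \<le> h1_norm (\<lambda>x. f x - g x)"
proof -
  let ?d = "\<lambda>x. f x - g x"
  let ?D = "\<lambda>x. weak_grad f x - weak_grad g x"
  have d: "?d \<in> H1" by (rule H1_diff[OF f g])
  have D: "?D \<in> L2" by (intro L2_diff weak_grad_L2 f g)
  have "AE x in torus. weak_grad ?d x = ?D x"
    using f g d by (intro has_weak_grad_unique[of ?d _ ?d] has_weak_grad_diff has_weak_grad_weak_grad weak_grad_L2 H1_L2 D) auto
  then have "l2_norm (weak_grad ?d) = l2_norm ?D"
    by (intro l2_norm_cong_AE weak_grad_L2 d D)
  then have "h1_norm ?d = l2_norm (\<lambda>x. (?d x, ?D x))"
    using l2_inner_Pair[OF H1_L2[OF d] D H1_L2[OF d] D]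
    by (simp add: h1_norm_def l2_norm_square) (simp add: l2_norm_def)
  then show ?thesis
    using l2_norm_reverse_triangle[OF L2_Pair[OF H1_L2[OF f] weak_grad_L2[OF f]] L2_Pair[OF H1_L2[OF g] weak_grad_L2[OF g]]]
    by (simp add: h1_norm_eq_l2_norm f g)
qed

lemma leray_h1_norm_le:
  assumes f: "f \<in> H1"
  shows "h1_norm (leray f) \<le> h1_norm f"
proof -
  let ?G = "weak_grad f"
  have PG: "(\<lambda>x. \<chi> i. leray (\<lambda>y. ?G y $ i) x) \<in> L2"
    by (intro L2_vec leray_L2 L2_nth weak_grad_L2 f)
  have "l2_norm (weak_grad (leray f)) = l2_norm (\<lambda>x. \<chi> i. leray (\<lambda>y. ?G y $ i) x)"
    by (intro l2_norm_cong_AE weak_grad_leray weak_grad_L2 leray_H1 f PG)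
  then have "(l2_norm (weak_grad (leray f)))\<^sup>2 = (\<Sum>i\<in>UNIV. (l2_norm (leray (\<lambda>y. ?G y $ i)))\<^sup>2)"
    using l2_inner_vec[OF PG PG] by (simp add: l2_norm_square)
  also have "\<dots> \<le> (\<Sum>i\<in>UNIV. (l2_norm (\<lambda>y. ?G y $ i))\<^sup>2)"
    by (intro sum_mono power_mono leray_norm_le L2_nth weak_grad_L2 f l2_norm_nonneg)
  also have "\<dots> = (l2_norm ?G)\<^sup>2"
    using l2_inner_vec[OF weak_grad_L2[OF f] weak_grad_L2[OF f]] by (simp add: l2_norm_square)
  finally show ?thesis
    unfolding h1_norm_def
    by (intro real_sqrt_le_mono add_mono power_mono[OF leray_norm_le[OF H1_L2[OF f]] l2_norm_nonneg])
qed

lemma leray_h1_norm_diff_le: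
  assumes f: "f \<in> H1" and g: "g \<in> H1"
  shows "h1_norm (\<lambda>x. leray f x - leray g x) \<le> h1_norm (\<lambda>x. f x - g x)"
  using leray_h1_norm_le[OF H1_diff[OF f g]]
    h1_norm_cong_AE[OF leray_diff[OF H1_L2[OF f] H1_L2[OF g]] H1_diff[OF leray_H1[OF f] leray_H1[OF g]] leray_H1[OF H1_diff[OF f g]]]
  by simp

text \<open>The integrand is \<open>\<psi> \<cdot> \<nabla>(u \<cdot> v)\<close>.\<close>

lemma integral_divergence_free_product:
  assumes \<psi>: "smooth_torus \<psi>" and div: "\<And>x. divergence \<psi> x = 0"
    and u: "u \<in> L2" "U \<in> L2" "has_weak_grad u U" and v: "v \<in> L2" "V \<in> L2" "has_weak_grad v V"
  shows "integrable torus (\<lambda>x. \<Sum>i\<in>UNIV. \<psi> x $ i * (U x $ i \<bullet> v x + u x \<bullet> V x $ i))"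
    and "(LINT x|torus. (\<Sum>i\<in>UNIV. \<psi> x $ i * (U x $ i \<bullet> v x + u x \<bullet> V x $ i))) = 0"
proof -
  have \<psi>i: "smooth_torus (\<lambda>x. \<psi> x $ i)" for i by (rule smooth_torus_nth[OF \<psi>])
  \<comment> \<open>A and B are the coefficients of v and \<nabla>v in the integrand. Both are
    square integrable because u is in H^1 and \<psi> is smooth, so it suffices to treat wave fields
    in place of v.\<close>
  define A where "A x = (\<Sum>i\<in>UNIV. (\<psi> x $ i) *\<^sub>R (U x $ i))" for x
  define B where "B x = (\<chi> i. (\<psi> x $ i) *\<^sub>R u x)" for x
  have A: "A \<in> L2"
    unfolding A_def[abs_def] by (intro L2_sum L2_times_smooth L2_nth u \<psi>i)
  have B: "B \<in> L2"
    unfolding B_def[abs_def] by (intro L2_vec L2_times_smooth u \<psi>i)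
  have pointwise: "(\<Sum>i\<in>UNIV. \<psi> x $ i * (F x $ i \<bullet> g x + f x \<bullet> H x $ i)) =
      (\<Sum>i\<in>UNIV. (\<psi> x $ i) *\<^sub>R (F x $ i)) \<bullet> g x + (\<chi> i. (\<psi> x $ i) *\<^sub>R f x) \<bullet> H x" for f g :: "R3 \<Rightarrow> R3" and F H x
    by (simp add: inner_vec_def[of "\<chi> i. _ i"] inner_sum_left distrib_left sum.distrib)
  have "(\<lambda>x. (A x, B x)) \<in> orthogonal_complement wave_jets"
    unfolding orthogonal_complement_def
  proof (intro CollectI conjI ballI)
    show "(\<lambda>x. (A x, B x)) \<in> L2" by (rule L2_Pair[OF A B])
    fix J assume "J \<in> wave_jets"
    then obtain k c e where J: "J = (\<lambda>x. (wave k c x *\<^sub>R e, grad (\<lambda>x. wave k c x *\<^sub>R e) x))"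
      and k: "k \<in> frequencies" by (auto simp: wave_jets_def)
    note \<eta> = smooth_torus_wave[OF k, of c]
    have "l2_inner (\<lambda>x. (A x, B x)) J = l2_inner A (\<lambda>x. wave k c x *\<^sub>R e) + l2_inner B (grad (\<lambda>x. wave k c x *\<^sub>R e))"
      unfolding J by (rule l2_inner_Pair[OF A B wave_field_L2[OF k] wave_jet_grad_L2[OF k]])
    also have "l2_inner A (\<lambda>x. wave k c x *\<^sub>R e) = (\<Sum>i\<in>UNIV. l2_inner (\<lambda>x. wave k c x *\<^sub>R e) (\<lambda>x. (\<psi> x $ i) *\<^sub>R (U x $ i)))"
      unfolding A_def l2_inner_commute[of "\<lambda>x. \<Sum>i\<in>UNIV. _ x i"]
      by (intro l2_inner_sum_right L2_times_smooth L2_nth u \<psi>i wave_field_L2 k)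
    also have "l2_inner B (grad (\<lambda>x. wave k c x *\<^sub>R e)) =
        (\<Sum>i\<in>UNIV. l2_inner (\<lambda>x. (\<psi> x $ i) *\<^sub>R u x) (\<lambda>x. partial i (wave k c) x *\<^sub>R e))"
    proof -
      have "partial i (\<lambda>x. wave k c x *\<^sub>R e) = (\<lambda>x. partial i (wave k c) x *\<^sub>R e)" for i
        by (simp add: fun_eq_iff partial_scaleR \<eta>)
      then show ?thesis
        unfolding l2_inner_vec[OF B wave_jet_grad_L2[OF k]] by (simp add: B_def grad_nth)
    qed
    also have "(\<Sum>i\<in>UNIV. l2_inner (\<lambda>x. wave k c x *\<^sub>R e) (\<lambda>x. (\<psi> x $ i) *\<^sub>R (U x $ i)))
        + (\<Sum>i\<in>UNIV. l2_inner (\<lambda>x. (\<psi> x $ i) *\<^sub>R u x) (\<lambda>x. partial i (wave k c) x *\<^sub>R e))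
        = (\<Sum>i\<in>UNIV. - l2_inner u (\<lambda>x. (partial i \<psi> x $ i) *\<^sub>R (wave k c x *\<^sub>R e)))"
      unfolding sum.distrib[symmetric]
    proof (rule sum.cong[OF refl])
      fix i
      \<comment> \<open>Testing the weak gradient of u with this product moves the derivative onto
        \<psi> and the wave. Summed over i, the terms with derivatives of \<psi> combine to its
        divergence.\<close>
      let ?\<theta> = "\<lambda>x. \<psi> x $ i * wave k c x"
      have "(\<lambda>x. partial i ?\<theta> x *\<^sub>R e) =
          (\<lambda>x. (\<psi> x $ i * partial i (wave k c) x) *\<^sub>R e + (partial i \<psi> x $ i) *\<^sub>R (wave k c x *\<^sub>R e))"
        by (simp add: partial_mult[OF \<psi>i \<eta>] partial_nth[OF \<psi>] scaleR_add_left)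
      then have "l2_inner (\<lambda>x. partial i ?\<theta> x *\<^sub>R e) u =
          l2_inner (\<lambda>x. (\<psi> x $ i * partial i (wave k c) x) *\<^sub>R e) u
          + l2_inner (\<lambda>x. (partial i \<psi> x $ i) *\<^sub>R (wave k c x *\<^sub>R e)) u"
        by (simp only:) (intro l2_inner_add_left L2_smooth_scaleR L2_times_smooth smooth_torus_mult smooth_torus_nth
            smooth_torus_partial \<psi> \<eta> u)
      moreover have "l2_inner (\<lambda>x. ?\<theta> x *\<^sub>R e) (\<lambda>x. U x $ i) = l2_inner (\<lambda>x. wave k c x *\<^sub>R e) (\<lambda>x. (\<psi> x $ i) *\<^sub>R (U x $ i))"
        "l2_inner (\<lambda>x. (\<psi> x $ i * partial i (wave k c) x) *\<^sub>R e) u = l2_inner (\<lambda>x. (\<psi> x $ i) *\<^sub>R u x) (\<lambda>x. partial i (wave k c) x *\<^sub>R e)"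
        by (simp_all add: l2_inner_def inner_commute[of e] mult_ac)
      ultimately show "l2_inner (\<lambda>x. wave k c x *\<^sub>R e) (\<lambda>x. (\<psi> x $ i) *\<^sub>R (U x $ i))
          + l2_inner (\<lambda>x. (\<psi> x $ i) *\<^sub>R u x) (\<lambda>x. partial i (wave k c) x *\<^sub>R e)
          = - l2_inner u (\<lambda>x. (partial i \<psi> x $ i) *\<^sub>R (wave k c x *\<^sub>R e))"
        using has_weak_gradD[OF u(3,1,2) smooth_torus_mult[OF \<psi>i \<eta>], of i i e]
        by (simp add: l2_inner_commute[of _ u])
    qed
    also have "\<dots> = - (\<Sum>i\<in>UNIV. l2_inner u (\<lambda>x. (partial i \<psi> x $ i) *\<^sub>R (wave k c x *\<^sub>R e)))"
      by (rule sum_negf)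
    also have "(\<Sum>i\<in>UNIV. l2_inner u (\<lambda>x. (partial i \<psi> x $ i) *\<^sub>R (wave k c x *\<^sub>R e)))
        = l2_inner u (\<lambda>x. \<Sum>i\<in>UNIV. (partial i \<psi> x $ i) *\<^sub>R (wave k c x *\<^sub>R e))"
      by (rule l2_inner_sum_right[symmetric])
         (intro u L2_times_smooth wave_field_L2 k smooth_torus_nth smooth_torus_partial \<psi>)+
    also have "(\<lambda>x. \<Sum>i\<in>UNIV. (partial i \<psi> x $ i) *\<^sub>R (wave k c x *\<^sub>R e)) = (\<lambda>x. 0)"
      using div by (simp add: divergence_def flip: scaleR_left.sum sum_distrib_right)
    finally show "l2_inner (\<lambda>x. (A x, B x)) J = 0" by (simp add: l2_inner_def)
  qed
  from orthogonal_wave_jets[OF this v]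
  show "(LINT x|torus. (\<Sum>i\<in>UNIV. \<psi> x $ i * (U x $ i \<bullet> v x + u x \<bullet> V x $ i))) = 0"
    unfolding pointwise by (simp add: l2_inner_def A_def B_def)
  show "integrable torus (\<lambda>x. \<Sum>i\<in>UNIV. \<psi> x $ i * (U x $ i \<bullet> v x + u x \<bullet> V x $ i))"
    unfolding pointwise using integrable_inner_L2[OF A v(1)] integrable_inner_L2[OF B v(2)]
    by (simp add: A_def B_def)
qed

text \<open>The antisymmetric part of R has as Fourier coefficients the pairings of r with waves
  along k_i e_j - k_j e_i. This direction is orthogonal to k, so these waves are divergence free and
  the pairings vanish. No potential for r is constructed.\<close>

lemma weak_grad_symmetric:
  assumes r: "r \<in> L2" "R \<in> L2" "has_weak_grad r R"
    and orth: "\<And>z. z \<in> L2_sigma \<Longrightarrow> l2_inner r z = 0"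
  shows "AE x in torus. R x $ i $ j = R x $ j $ i"
proof -
  have R: "(\<lambda>x. R x $ i $ j) \<in> L2" for i j by (intro L2_nth r)
  have "AE x in torus. R x $ i $ j - R x $ j $ i = 0"
  proof (rule waves_complete[OF L2_diff[OF R R]])
    fix k c assume k: "k \<in> frequencies"
    let ?w = "wave k (c + pi / 2)"
    have comp: "l2_inner (\<lambda>x. R x $ a $ b) (wave k c) = - (k $ a) * l2_inner r (\<lambda>x. ?w x *\<^sub>R axis b 1)" for a b
      using has_weak_grad_wave[OF r(3,1,2) k, of a c "axis b 1"]
      by (simp add: l2_inner_def inner_axis mult.commute)
    have "k \<bullet> ((k $ i) *\<^sub>R axis j 1 - (k $ j) *\<^sub>R axis i 1) = 0"
      by (simp add: inner_diff_right inner_axis)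
    from orth[OF wave_field_L2_sigma[OF k this, of "c + pi / 2"]]
    have "l2_inner r (\<lambda>x. (k $ i) *\<^sub>R (?w x *\<^sub>R axis j 1) - (k $ j) *\<^sub>R (?w x *\<^sub>R axis i 1)) = 0"
      by (simp add: scaleR_diff_right mult.commute)
    then have "k $ i * l2_inner r (\<lambda>x. ?w x *\<^sub>R axis j 1) - k $ j * l2_inner r (\<lambda>x. ?w x *\<^sub>R axis i 1) = 0"
      using l2_inner_diff_right[OF L2_scaleR[OF wave_field_L2[OF k]] L2_scaleR[OF wave_field_L2[OF k]] r(1)]
      by (simp only: l2_inner_scaleR)
    then show "l2_inner (\<lambda>x. R x $ i $ j - R x $ j $ i) (wave k c) = 0"
      using l2_inner_diff_left[OF R R smooth_torus_L2[OF smooth_torus_wave[OF k]]] by (simp add: comp)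
  qed
  then show ?thesis by simp
qed

section \<open>The weak formulations\<close>

text \<open>By completeness of the measure, f and g are both measurable or both not. In the latter
  case both integrals have the default value 0, so integrands can be exchanged without examining
  their measurability.\<close>

lemma integral_cong_AE_lebesgue:
  fixes f g :: "'a::euclidean_space \<Rightarrow> real"
  assumes "AE x in lebesgue. f x = g x"
  shows "(LINT x|lebesgue. f x) = (LINT x|lebesgue. g x)"
proof (cases "f \<in> borel_measurable lebesgue")
  case True
  then show ?thesis
    by (rule integral_cong_AE[OF _ borel_measurable_AE[OF True assms] assms])
next
  case False
  have "AE x in lebesgue. g x = f x" using assms by eventually_elim simp
  with False have "g \<notin> borel_measurable lebesgue"
    using borel_measurable_AE by blast
  with False show ?thesis
    by (metis borel_measurable_integrable not_integrable_integral_eq)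
qed

lemma set_integral_cong_AE_lebesgue:
  fixes f g :: "'a::euclidean_space \<Rightarrow> real"
  assumes "AE x in lebesgue. x \<in> A \<longrightarrow> f x = g x"
  shows "(LINT x:A|lebesgue. f x) = (LINT x:A|lebesgue. g x)"
  unfolding set_lebesgue_integral_def
proof (rule integral_cong_AE_lebesgue)
  show "AE x in lebesgue. indicator A x *\<^sub>R f x = indicator A x *\<^sub>R g x"
    using assms by eventually_elim (simp add: indicator_def)
qed

lemma integral_cong_AE_torus:
  fixes f g :: "R3 \<Rightarrow> real"
  assumes "AE x in torus. f x = g x"
  shows "(LINT x|torus. f x) = (LINT x|torus. g x)"
proof -
  have "AE x in lebesgue. x \<in> cbox 0 (\<chi> i. 2 * pi) \<longrightarrow> f x = g x"
    using assms unfolding torus_def by (subst (asm) AE_restrict_space_iff) auto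
  from set_integral_cong_AE_lebesgue[OF this] show ?thesis
    unfolding torus_def set_lebesgue_integral_def by (simp add: integral_restrict_space)
qed

lemma nonlinear_term_leray:
  assumes w: "w \<in> H1" and \<psi>: "smooth_torus \<psi>" and div: "\<And>x. divergence \<psi> x = 0"
  shows "l2_inner (\<lambda>x. convect (leray w) w x + grad_transp (leray w) w x) \<psi>
    = l2_inner (convect (leray w) (leray w)) \<psi>"
proof -
  define u where "u = leray w"
  define r where "r x = w x - u x" for x
  define U where "U = weak_grad u"
  define R where "R x = weak_grad w x - U x" for x
  have uH1: "u \<in> H1" unfolding u_def by (rule leray_H1[OF w])
  have u: "u \<in> L2" "U \<in> L2" "has_weak_grad u U"
    unfolding U_def by (intro H1_L2 weak_grad_L2 has_weak_grad_weak_grad uH1)+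
  have r: "r \<in> L2" "R \<in> L2" "has_weak_grad r R"
    unfolding r_def[abs_def] R_def[abs_def]
    by (intro L2_diff has_weak_grad_diff u H1_L2 weak_grad_L2 has_weak_grad_weak_grad w)+
  have "l2_inner r z = 0" if "z \<in> L2_sigma" for z
    using leray_orthogonal[OF H1_L2[OF w] that] by (simp add: r_def[abs_def] u_def)
  then have sym: "AE x in torus. R x $ i $ j = R x $ j $ i" for i j
    by (rule weak_grad_symmetric[OF r])
  then have "AE x in torus. \<forall>i\<in>UNIV. \<forall>j\<in>UNIV. R x $ i $ j = R x $ j $ i"
    by (intro AE_finite_allI finite)
  \<comment> \<open>These are \<psi> . \<nabla>(u . r) and \<psi> . \<nabla>(|u|^2). The square
    contributes with weight one half below, because only (\<nabla>u)^T u occurs in the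
    equation.\<close>
  define A where "A x = (\<Sum>i\<in>UNIV. \<psi> x $ i * (U x $ i \<bullet> r x + u x \<bullet> R x $ i))" for x
  define B where "B x = (\<Sum>i\<in>UNIV. \<psi> x $ i * (U x $ i \<bullet> u x + u x \<bullet> U x $ i))" for x
  have A: "integrable torus A" "(LINT x|torus. A x) = 0"
    unfolding A_def[abs_def] by (rule integral_divergence_free_product[OF \<psi> div u r])+
  have B: "integrable torus B" "(LINT x|torus. B x) = 0"
    unfolding B_def[abs_def] by (rule integral_divergence_free_product[OF \<psi> div u u])+
  \<comment> \<open>Integrability of the remaining convection term is needed to split the final
    integral; it is a sum of products of L^2 fields.\<close>
  have "integrable torus (\<lambda>x. \<Sum>j\<in>UNIV. U x $ j \<bullet> (\<chi> i. \<psi> x $ i *\<^sub>R u x $ j))"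
    by (intro Bochner_Integration.integrable_sum integrable_inner_L2 L2_vec L2_times_smooth L2_nth u
        smooth_torus_nth \<psi>)
  moreover have "(\<Sum>j\<in>UNIV. U x $ j \<bullet> (\<chi> i. \<psi> x $ i *\<^sub>R u x $ j)) = convect u u x \<bullet> \<psi> x" for x
    by (simp add: convect_def U_def inner_sum_left inner_vec_def sum_distrib_left mult_ac) (rule sum.swap)
  ultimately have C: "integrable torus (\<lambda>x. convect u u x \<bullet> \<psi> x)" by simp
  have "AE x in torus. (convect u w x + grad_transp u w x) \<bullet> \<psi> x = convect u u x \<bullet> \<psi> x + (A x + B x / 2)"
    using \<open>AE x in torus. \<forall>i\<in>UNIV. \<forall>j\<in>UNIV. R x $ i $ j = R x $ j $ i\<close>
  proof eventually_elim
    case (elim x)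
    \<comment> \<open>Here the symmetry of R enters: \<partial>_j r_i is rewritten as \<partial>_i
      r_j, which turns (u . \<nabla>)r into the half of \<nabla>(u . r) that (\<nabla>u)^T r
      lacks.\<close>
    have ww: "weak_grad w x $ j $ i = U x $ j $ i + R x $ i $ j" "w x $ j = u x $ j + r x $ j" for i j
    proof -
      have "R x $ i $ j = R x $ j $ i" using elim by blast
      then show "weak_grad w x $ j $ i = U x $ j $ i + R x $ i $ j" by (simp only:) (simp add: R_def)
      show "w x $ j = u x $ j + r x $ j" by (simp add: r_def)
    qed
    have "(convect u w x + grad_transp u w x) $ i =
        convect u u x $ i + ((U x $ i \<bullet> r x + u x \<bullet> R x $ i) + (U x $ i \<bullet> u x + u x \<bullet> U x $ i) / 2)" for i
      unfolding convect_def grad_transp_def U_def[symmetric] inner_vec_def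
      by (simp add: ww sum_divide_distrib sum.distrib[symmetric])
         (rule sum.cong[OF refl], simp add: field_simps)
    then have "(convect u w x + grad_transp u w x) \<bullet> \<psi> x = (\<Sum>i\<in>UNIV. \<psi> x $ i * (convect u u x $ i +
        ((U x $ i \<bullet> r x + u x \<bullet> R x $ i) + (U x $ i \<bullet> u x + u x \<bullet> U x $ i) / 2)))"
      by (simp only: inner_vec_def[of "convect u w x + grad_transp u w x"] inner_real_def mult.commute)
    also have "\<dots> = (\<Sum>i\<in>UNIV. \<psi> x $ i * convect u u x $ i) + (A x + B x / 2)"
      unfolding A_def B_def sum_divide_distrib sum.distrib[symmetric] by (simp add: algebra_simps)
    also have "(\<Sum>i\<in>UNIV. \<psi> x $ i * convect u u x $ i) = convect u u x \<bullet> \<psi> x"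
      by (simp add: inner_vec_def mult.commute)
    finally show ?case .
  qed
  from integral_cong_AE_torus[OF this]
  have "l2_inner (\<lambda>x. convect u w x + grad_transp u w x) \<psi> = (LINT x|torus. convect u u x \<bullet> \<psi> x + (A x + B x / 2))"
    by (simp add: l2_inner_def)
  also have "\<dots> = l2_inner (convect u u) \<psi>"
    using A B C by (simp add: l2_inner_def)
  finally show ?thesis by (simp add: u_def)
qed

text \<open>A divergence-free \<psi> equals its projection, and so does each row of its gradient.
  The projection can then be moved to the rows of the gradient of w, where it commutes with
  differentiation.\<close>

lemma viscous_term_leray:
  assumes w: "w \<in> H1" and \<psi>: "smooth_torus \<psi>" and div: "\<And>x. divergence \<psi> x = 0"
  shows "l2_inner (weak_grad w) (grad \<psi>) = l2_inner (weak_grad (leray w)) (grad \<psi>)"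
proof -
  have \<psi>L2: "\<psi> \<in> L2" and \<psi>G: "grad \<psi> \<in> L2" by (intro smooth_torus_L2 grad_L2 \<psi>)+
  have \<psi>Gi: "(\<lambda>x. grad \<psi> x $ i) \<in> L2" for i by (rule L2_nth[OF \<psi>G])
  have W: "weak_grad w \<in> L2" "(\<lambda>x. weak_grad w x $ i) \<in> L2" for i
    by (intro L2_nth weak_grad_L2 w)+
  let ?PW = "\<lambda>x. \<chi> i. leray (\<lambda>y. weak_grad w y $ i) x"
  let ?PG = "\<lambda>x. \<chi> i. leray (\<lambda>y. grad \<psi> y $ i) x"
  have PW: "?PW \<in> L2" and PG: "?PG \<in> L2" by (intro L2_vec leray_L2 W \<psi>Gi)+
  have "AE x in torus. \<psi> x = leray \<psi> x"
    by (intro leray_fixed divergence_free_L2_sigma \<psi> div)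
  then have AEG: "AE x in torus. grad \<psi> x = ?PG x"
    by (rule has_weak_grad_unique[OF has_weak_grad_smooth[OF \<psi>] leray_has_weak_grad[OF \<psi>L2 \<psi>G has_weak_grad_smooth[OF \<psi>]]
        \<psi>L2 leray_L2[OF \<psi>L2] \<psi>G PG])
  have "l2_inner (weak_grad w) (grad \<psi>) = l2_inner (weak_grad w) ?PG"
    using AEG by (intro l2_inner_cong_AE W \<psi>G PG) auto
  also have "\<dots> = l2_inner ?PW ?PG"
    unfolding l2_inner_vec[OF W(1) PG] l2_inner_vec[OF PW PG]
    by (simp add: leray_inner[OF W(2) leray_L2_sigma[OF \<psi>Gi]])
  also have "\<dots> = l2_inner (weak_grad (leray w)) (grad \<psi>)"
    using AEG weak_grad_leray[OF w]
    by (intro l2_inner_cong_AE PW PG \<psi>G weak_grad_L2 leray_H1 w) (auto simp: eq_commute)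
  finally show ?thesis .
qed

section \<open>Time slices and time derivatives of test fields\<close>

lemma Ck_on_slice:
  fixes f :: "real \<times> R3 \<Rightarrow> 'b::real_normed_vector"
  assumes "t \<in> A"
  shows "Ck_on k (A \<times> UNIV) f \<Longrightarrow> Ck_on k UNIV (\<lambda>x. f (t, x))"
proof (induction k arbitrary: f)
  case 0
  then show ?case
    using assms by (auto intro!: continuous_intros elim!: continuous_on_compose2)
next
  case (Suc k)
  from Suc.prems obtain f' where f': "\<And>p. p \<in> A \<times> UNIV \<Longrightarrow> (f has_derivative f' p) (at p within A \<times> UNIV)"
      "\<And>v. Ck_on k (A \<times> UNIV) (\<lambda>p. f' p v)"
    by auto
  have "((\<lambda>x. f (t, x)) has_derivative (\<lambda>v. f' (t, x) (0, v))) (at x)" for x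
  proof (rule has_derivative_in_compose2[OF f'(1)])
    show "(Pair t has_derivative Pair 0) (at x)"
      by (auto intro!: derivative_eq_intros)
  qed (use assms in auto)
  then show ?case
    using Suc.IH[OF f'(2)] by (auto intro!: exI[of _ "\<lambda>x v. f' (t, x) (0, v)"])
qed

lemma test_field_smooth:
  assumes "test_field T \<phi>" "t \<in> {0..<T}"
  shows "smooth_torus (\<phi> t)"
  using assms Ck_on_slice[OF assms(2), of _ "\<lambda>(t, x). \<phi> t x"]
  by (auto simp: test_field_def smooth_torus_def smooth_on_def)

text \<open>Difference quotients in time of divergence-free fields are divergence free, and
  orthogonality to gradients survives a bounded pointwise limit. This avoids exchanging mixed
  derivatives. Forward quotients are used because they exist at t = 0 as well.\<close>

lemma time_deriv_L2_sigma:
  assumes \<psi>: "test_field T \<psi>" and div: "\<And>t x. t \<in> {0..<T} \<Longrightarrow> divergence (\<psi> t) x = 0"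
    and t: "t \<in> {0..<T}"
  shows "time_deriv T \<psi> t \<in> L2_sigma"
proof -
  let ?S = "{0..<T} \<times> (UNIV :: R3 set)"
  have "Ck_on (Suc 0) ?S (\<lambda>(t, x). \<psi> t x)" using \<psi> by (simp add: test_field_def smooth_on_def)
  then obtain f' where f': "\<And>p. p \<in> ?S \<Longrightarrow> ((\<lambda>(t, x). \<psi> t x) has_derivative f' p) (at p within ?S)"
      and cf': "\<And>v. continuous_on ?S (\<lambda>p. f' p v)"
    by auto
  define g where "g p = f' p (1, 0)" for p
  have cg: "continuous_on ?S g" unfolding g_def[abs_def] by (rule cf')
  have dtime: "((\<lambda>r. \<psi> r x) has_vector_derivative g (s, x)) (at s within {0..<T})" if "s \<in> {0..<T}" for s x
  proof -
    have "((\<lambda>r. (\<lambda>(t, x). \<psi> t x) (r, x)) has_derivative (\<lambda>h. f' (s, x) (h, 0))) (at s within {0..<T})"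
      by (rule has_derivative_in_compose2[OF f']) (use that in \<open>auto intro!: derivative_eq_intros\<close>)
    moreover have "f' (s, x) (h, 0) = h *\<^sub>R g (s, x)" for h
    proof -
      have "linear (f' (s, x))" using f'[of "(s, x)"] that by (auto intro: has_derivative_linear)
      from linear_scale[OF this, of h "(1, 0)"] show ?thesis by (simp add: g_def)
    qed
    ultimately show ?thesis by (simp add: has_vector_derivative_def)
  qed
  \<comment> \<open>At an isolated point \<open>vector_derivative\<close> would not be determined by
    the derivative found above.\<close>
  have "t islimpt {0..<T}"
  proof (rule connected_imp_perfect)
    show "{0..<T} \<noteq> {y}" for y
    proof
      assume "{0..<T} = {y}"
      moreover have "t \<in> {0..<T}" "(t + T) / 2 \<in> {0..<T}" using t by auto
      ultimately show False using t by auto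
    qed
  qed (use t in auto)
  then have nontriv: "at t within {0..<T} \<noteq> bot" by (simp add: trivial_limit_within)
  have td: "time_deriv T \<psi> t = (\<lambda>x. g (t, x))"
    unfolding time_deriv_def[abs_def] by (intro ext vector_derivative_within nontriv dtime t)
  \<comment> \<open>The \<open>+ 2\<close> keeps \<open>t + h n\<close> at or below (t + T) / 2, so
    every segment of times lies in a fixed compact part of the half-open interval, on which g is
    bounded.\<close>
  define h where "h n = (T - t) / (real n + 2)" for n :: nat
  have h: "h n > 0" "h n \<le> (T - t) / 2" "t + h n \<in> {0..<T}" for n
  proof -
    show "h n > 0" using t by (simp add: h_def)
    show "h n \<le> (T - t) / 2" unfolding h_def by (rule divide_left_mono) (use t in auto)
    then show "t + h n \<in> {0..<T}" using t \<open>h n > 0\<close> by (auto simp: field_simps)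
  qed
  have "(\<lambda>n. (T - t) * inverse (real (Suc (Suc n)))) \<longlonglongrightarrow> (T - t) * 0"
    by (intro tendsto_intros LIMSEQ_Suc[OF LIMSEQ_inverse_real_of_nat])
  then have h0: "h \<longlonglongrightarrow> 0"
    by (simp add: h_def[abs_def] divide_inverse add.commute)
  define q where "q n x = (1 / h n) *\<^sub>R (\<psi> (t + h n) x - \<psi> t x)" for n x
  have sm: "smooth_torus (\<psi> s)" if "s \<in> {0..<T}" for s by (rule test_field_smooth[OF \<psi> that])
  have \<psi>\<sigma>: "\<psi> s \<in> L2_sigma" if "s \<in> {0..<T}" for s
    using div[OF that] by (intro divergence_free_L2_sigma sm that)
  have qL2: "q n \<in> L2" for n
    unfolding q_def[abs_def] by (intro L2_scaleR L2_diff L2_sigma_L2 \<psi>\<sigma> h t)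
  have qorth: "l2_inner (q n) (grad \<theta>) = 0" if "smooth_torus \<theta>" for n and \<theta> :: "R3 \<Rightarrow> real"
  proof -
    have "l2_inner (\<lambda>x. \<psi> (t + h n) x - \<psi> t x) (grad \<theta>) = 0"
      using L2_sigma_diff[OF \<psi>\<sigma>[OF h(3)] \<psi>\<sigma>[OF t]] that by (auto simp: L2_sigma_def)
    then show ?thesis unfolding q_def[abs_def] by (simp only: l2_inner_scaleR)
  qed
  have qlim: "(\<lambda>n. q n x) \<longlonglongrightarrow> g (t, x)" for x
  proof -
    have "((\<lambda>s. norm (\<psi> s x - \<psi> t x - (s - t) *\<^sub>R g (t, x)) / norm (s - t)) \<longlongrightarrow> 0) (at t within {0..<T})"
      using dtime[OF t, of x] by (simp add: has_vector_derivative_def has_derivative_iff_norm)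
    moreover have "filterlim (\<lambda>n. t + h n) (at t within {0..<T}) sequentially"
      unfolding filterlim_at
    proof
      show "\<forall>\<^sub>F n in sequentially. t + h n \<in> {0..<T} \<and> t + h n \<noteq> t"
        using h by (intro always_eventually allI conjI) (simp_all add: less_imp_neq[symmetric])
      show "(\<lambda>n. t + h n) \<longlonglongrightarrow> t" using tendsto_add[OF tendsto_const[of t] h0] by simp
    qed
    ultimately have lim: "(\<lambda>n. norm (\<psi> (t + h n) x - \<psi> t x - (t + h n - t) *\<^sub>R g (t, x)) / norm (t + h n - t)) \<longlonglongrightarrow> 0"
      by (rule filterlim_compose)
    have "norm (q n x - g (t, x)) = norm (\<psi> (t + h n) x - \<psi> t x - (t + h n - t) *\<^sub>R g (t, x)) / norm (t + h n - t)" for n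
    proof -
      have "q n x - g (t, x) = (1 / h n) *\<^sub>R (\<psi> (t + h n) x - \<psi> t x - h n *\<^sub>R g (t, x))"
        using h(1)[of n] by (simp add: q_def scaleR_diff_right)
      then show ?thesis using h(1)[of n] by simp
    qed
    with lim have "(\<lambda>n. norm (q n x - g (t, x))) \<longlonglongrightarrow> 0" by (simp only:)
    then show ?thesis by (rule LIM_zero_cancel[OF tendsto_norm_zero_cancel])
  qed
  have per: "periodic (\<lambda>x. g (t, x))"
    unfolding periodic_def
  proof (intro allI)
    fix x i
    have "q n (x + (2 * pi) *\<^sub>R axis i 1) = q n x" for n
      using L2_periodic[OF qL2] by (simp add: periodic_def)
    then show "g (t, x + (2 * pi) *\<^sub>R axis i 1) = g (t, x)"
      using qlim[of "x + (2 * pi) *\<^sub>R axis i 1"] qlim[of x] by (intro LIMSEQ_unique) auto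
  qed
  have cgt: "continuous_on UNIV (\<lambda>x. g (t, x))"
    by (rule continuous_on_compose2[OF cg]) (use t in \<open>auto intro!: continuous_intros\<close>)
  have gL2: "(\<lambda>x. g (t, x)) \<in> L2" by (rule continuous_L2[OF cgt per])
  let ?K = "{t..(t + T) / 2} \<times> cbox 0 (\<chi> i. 2 * pi) :: (real \<times> R3) set"
  have "?K \<subseteq> ?S" using t by auto
  then have "bounded (g ` ?K)"
    by (intro compact_imp_bounded compact_continuous_image continuous_on_subset[OF cg] compact_Times compact_cbox
        compact_Icc)
  then obtain M where M: "\<And>p. p \<in> ?K \<Longrightarrow> norm (g p) \<le> M"
    by (auto simp: bounded_iff)
  have qbound: "norm (q n x) \<le> M" if x: "x \<in> cbox 0 (\<chi> i. 2 * pi)" for n x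
  proof -
    have sub: "{t..t + h n} \<subseteq> {0..<T}" using t h(3)[of n] by auto
    have "norm (\<psi> (t + h n) x - \<psi> t x) \<le> M * norm (t + h n - t)"
    proof (rule differentiable_bound)
      fix s assume s: "s \<in> {t..t + h n}"
      show "((\<lambda>r. \<psi> r x) has_derivative (\<lambda>y. y *\<^sub>R g (s, x))) (at s within {t..t + h n})"
        using has_vector_derivative_within_subset[OF dtime sub] s sub
        by (auto simp: has_vector_derivative_def)
      have "(s, x) \<in> ?K" using s h(2)[of n] x by (auto simp: field_simps)
      then show "onorm (\<lambda>y. y *\<^sub>R g (s, x)) \<le> M"
        using M[of "(s, x)"]
        by (intro onorm_le) (simp only: norm_scaleR real_norm_def mult.commute[of M] mult_left_mono abs_ge_zero)
    qed (use h(1)[of n] in auto)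
    then have "norm (\<psi> (t + h n) x - \<psi> t x) \<le> M * h n" using h(1)[of n] by simp
    moreover have "norm (q n x) = norm (\<psi> (t + h n) x - \<psi> t x) / h n"
      using h(1)[of n] by (simp add: q_def)
    ultimately show ?thesis using h(1)[of n] by (simp add: pos_divide_le_eq)
  qed
  have "l2_inner (\<lambda>x. g (t, x)) (grad \<theta>) = 0" if \<theta>: "smooth_torus \<theta>" for \<theta> :: "R3 \<Rightarrow> real"
  proof -
    have G: "grad \<theta> \<in> L2" by (rule grad_L2[OF \<theta>])
    have "(\<lambda>n. LINT x|torus. q n x \<bullet> grad \<theta> x) \<longlonglongrightarrow> (LINT x|torus. g (t, x) \<bullet> grad \<theta> x)"
    proof (rule integral_dominated_convergence[where w = "\<lambda>x. M * norm (grad \<theta> x)"])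
      show "integrable torus (\<lambda>x. M * norm (grad \<theta> x))"
        using L2_integrable[OF G] by auto
      show "AE x in torus. (\<lambda>n. q n x \<bullet> grad \<theta> x) \<longlonglongrightarrow> g (t, x) \<bullet> grad \<theta> x"
        by (intro AE_I2 tendsto_intros qlim)
      show "AE x in torus. norm (q n x \<bullet> grad \<theta> x) \<le> M * norm (grad \<theta> x)" for n
      proof (rule AE_I2)
        fix x assume "x \<in> space torus"
        then have "norm (q n x) * norm (grad \<theta> x) \<le> M * norm (grad \<theta> x)"
          by (intro mult_right_mono qbound) auto
        then show "norm (q n x \<bullet> grad \<theta> x) \<le> M * norm (grad \<theta> x)"
          using Cauchy_Schwarz_ineq2[of "q n x" "grad \<theta> x"] by simp
      qed
      show "(\<lambda>x. g (t, x) \<bullet> grad \<theta> x) \<in> borel_measurable torus"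
        by (rule borel_measurable_integrable[OF integrable_inner_L2[OF gL2 G]])
      show "(\<lambda>x. q n x \<bullet> grad \<theta> x) \<in> borel_measurable torus" for n
        by (rule borel_measurable_integrable[OF integrable_inner_L2[OF qL2 G]])
    qed
    then show ?thesis
      using qorth[OF \<theta>] by (simp add: l2_inner_def LIMSEQ_const_iff)
  qed
  then show ?thesis by (simp add: td L2_sigma_def gL2)
qed

text \<open>A nonexpansive map sends simple functions to simple functions and preserves the
  convergence. Both the L^2 and the H^1 membership of the projected solution are obtained from
  it.\<close>

lemma strongly_measurable_map:
  assumes w: "strongly_measurable T X N w" and PX: "\<And>f. f \<in> X \<Longrightarrow> P f \<in> X"
    and lipschitz: "\<And>f g. f \<in> X \<Longrightarrow> g \<in> X \<Longrightarrow> N (\<lambda>x. P f x - P g x) \<le> N (\<lambda>x. f x - g x)"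
    and nonneg: "\<And>f. N f \<ge> 0"
  shows "strongly_measurable T X N (\<lambda>t. P (w t))"
proof -
  from w obtain s where wX: "AE t in lebesgue_on {0<..<T}. w t \<in> X"
    and s: "\<And>n. simple_function (lebesgue_on {0<..<T}) (s n)" "\<And>n t. t \<in> {0<..<T} \<Longrightarrow> s n t \<in> X"
    and lim: "AE t in lebesgue_on {0<..<T}. (\<lambda>n. N (\<lambda>x. s n t x - w t x)) \<longlonglongrightarrow> 0"
    unfolding strongly_measurable_def by blast
  have "AE t in lebesgue_on {0<..<T}. P (w t) \<in> X"
    using wX by eventually_elim (rule PX)
  moreover have "AE t in lebesgue_on {0<..<T}. (\<lambda>n. N (\<lambda>x. P (s n t) x - P (w t) x)) \<longlonglongrightarrow> 0"
    using wX lim AE_space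
  proof eventually_elim
    case (elim t)
    then have t: "t \<in> {0<..<T}" by simp
    have "norm (N (\<lambda>x. P (s n t) x - P (w t) x)) \<le> N (\<lambda>x. s n t x - w t x)" for n
      using lipschitz[OF s(2)[OF t] elim(1), of n] nonneg by simp
    then show ?case
      by (intro Lim_null_comparison[OF always_eventually elim(2)]) simp
  qed
  moreover have "simple_function (lebesgue_on {0<..<T}) (\<lambda>t. P (s n t))" for n
    by (rule simple_function_compose1[OF s(1)])
  ultimately show ?thesis
    unfolding strongly_measurable_def using s(2) PX
    by (intro conjI exI[of _ "\<lambda>n t. P (s n t)"]) auto
qed

text \<open>Domination by the norm of w yields square integrability of the projected norm only once
  that norm is known to be measurable; it is an almost everywhere limit of the norms of simple
  functions.\<close>

lemma strongly_measurable_norm: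
  assumes w: "strongly_measurable T X N w"
    and triangle: "\<And>f g. f \<in> X \<Longrightarrow> g \<in> X \<Longrightarrow> \<bar>N f - N g\<bar> \<le> N (\<lambda>x. f x - g x)"
  shows "(\<lambda>t. N (w t)) \<in> borel_measurable (lebesgue_on {0<..<T})"
proof -
  from w obtain s where wX: "AE t in lebesgue_on {0<..<T}. w t \<in> X"
    and s: "\<And>n. simple_function (lebesgue_on {0<..<T}) (s n)" "\<And>n t. t \<in> {0<..<T} \<Longrightarrow> s n t \<in> X"
    and lim: "AE t in lebesgue_on {0<..<T}. (\<lambda>n. N (\<lambda>x. s n t x - w t x)) \<longlonglongrightarrow> 0"
    unfolding strongly_measurable_def by blast
  \<comment> \<open>Extension by zero transfers the question to the complete Lebesgue measure on the
    line, where a function equal almost everywhere to a measurable one is measurable.\<close>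
  define I :: "real \<Rightarrow> real" where "I = indicator {0<..<T}"
  have meas: "(\<lambda>t. I t *\<^sub>R N (s n t)) \<in> borel_measurable lebesgue" for n
    using borel_measurable_simple_function[OF simple_function_compose1[OF s(1)], of N n]
    unfolding I_def by (subst (asm) borel_measurable_restrict_space_iff) auto
  have "AE t in lebesgue_on {0<..<T}. (\<lambda>n. N (s n t)) \<longlonglongrightarrow> N (w t)"
    using wX lim AE_space
  proof eventually_elim
    case (elim t)
    then have t: "t \<in> {0<..<T}" by simp
    have "norm (N (s n t) - N (w t)) \<le> N (\<lambda>x. s n t x - w t x)" for n
      using triangle[OF s(2)[OF t] elim(1), of n] by simp
    then have "(\<lambda>n. N (s n t) - N (w t)) \<longlonglongrightarrow> 0"
      by (intro Lim_null_comparison[OF always_eventually elim(2)]) simp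
    then show ?case by (rule LIM_zero_cancel)
  qed
  then have "AE t in lebesgue. t \<in> {0<..<T} \<longrightarrow> (\<lambda>n. N (s n t)) \<longlonglongrightarrow> N (w t)"
    by (subst (asm) AE_restrict_space_iff) auto
  then have "AE t in lebesgue. lim (\<lambda>n. I t *\<^sub>R N (s n t)) = I t *\<^sub>R N (w t)"
  proof eventually_elim
    case (elim t)
    then have "(\<lambda>n. I t *\<^sub>R N (s n t)) \<longlonglongrightarrow> I t *\<^sub>R N (w t)"
      by (cases "t \<in> {0<..<T}") (auto simp: I_def)
    then show ?case by (rule limI)
  qed
  then have "(\<lambda>t. I t *\<^sub>R N (w t)) \<in> borel_measurable lebesgue"
    by (rule borel_measurable_AE[rotated]) (intro borel_measurable_lim_metric meas)
  then show ?thesis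
    unfolding I_def by (subst borel_measurable_restrict_space_iff) auto
qed

theorem proposition4:
  fixes T :: real and w0 :: "R3 \<Rightarrow> R3" and w :: "real \<Rightarrow> R3 \<Rightarrow> R3"
  assumes "T > 0"
    and "weak_solution_w T w0 w"
  shows "weak_solution_NS T (leray w0) (\<lambda>t. leray (w t))"
proof -
  have w0: "w0 \<in> L2" and wL2: "\<And>t. t \<in> {0..<T} \<Longrightarrow> w t \<in> L2"
    and wLinf: "w \<in> Linf_L2 T" and wH1: "w \<in> L2_H1 T"
    and eq: "\<And>\<phi> t. test_field T \<phi> \<Longrightarrow> t \<in> {0..<T} \<Longrightarrow>
        l2_inner (w t) (\<phi> t)
          + (LINT s:{0..t}|lebesgue.
               l2_inner (\<lambda>x. convect (leray (w s)) (w s) x + grad_transp (leray (w s)) (w s) x) (\<phi> s)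
               + l2_inner (weak_grad (w s)) (grad (\<phi> s)))
        = l2_inner w0 (\<phi> 0) + (LINT s:{0..t}|lebesgue. l2_inner (w s) (time_deriv T \<phi> s))"
    using assms(2) unfolding weak_solution_w_def by blast+
  have AEH1: "AE t in lebesgue_on {0<..<T}. w t \<in> H1"
    using wH1 by (auto simp: L2_H1_def strongly_measurable_def)
  have "(\<lambda>t. leray (w t)) \<in> Linf_L2 T"
  proof -
    from wLinf obtain C where sm: "strongly_measurable T L2 l2_norm w"
      and C: "AE t in lebesgue_on {0<..<T}. l2_norm (w t) \<le> C"
      by (auto simp: Linf_L2_def)
    have "AE t in lebesgue_on {0<..<T}. l2_norm (leray (w t)) \<le> C"
      using C AE_space
    proof eventually_elim
      case (elim t)
      then have "w t \<in> L2" by (intro wL2) auto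
      then show ?case using leray_norm_le[of "w t"] elim(1) by simp
    qed
    moreover have "strongly_measurable T L2 l2_norm (\<lambda>t. leray (w t))"
      by (intro strongly_measurable_map[OF sm] leray_L2 leray_norm_diff_le l2_norm_nonneg)
    ultimately show ?thesis by (auto simp: Linf_L2_def)
  qed
  moreover have "(\<lambda>t. leray (w t)) \<in> L2_H1 T"
  proof -
    from wH1 have sm: "strongly_measurable T H1 h1_norm w"
      and int: "integrable (lebesgue_on {0<..<T}) (\<lambda>t. (h1_norm (w t))\<^sup>2)"
      by (auto simp: L2_H1_def)
    have sm': "strongly_measurable T H1 h1_norm (\<lambda>t. leray (w t))"
      by (intro strongly_measurable_map[OF sm] leray_H1 leray_h1_norm_diff_le h1_norm_nonneg)
    have "(\<lambda>t. h1_norm (leray (w t))) \<in> borel_measurable (lebesgue_on {0<..<T})"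
      by (intro strongly_measurable_norm[OF sm'] h1_norm_reverse_triangle)
    then have meas: "(\<lambda>t. (h1_norm (leray (w t)))\<^sup>2) \<in> borel_measurable (lebesgue_on {0<..<T})"
      by (rule borel_measurable_power)
    have "AE t in lebesgue_on {0<..<T}. norm ((h1_norm (leray (w t)))\<^sup>2) \<le> norm ((h1_norm (w t))\<^sup>2)"
      using AEH1 by eventually_elim (simp add: power_mono leray_h1_norm_le h1_norm_nonneg)
    with int meas have "integrable (lebesgue_on {0<..<T}) (\<lambda>t. (h1_norm (leray (w t)))\<^sup>2)"
      by (rule Bochner_Integration.integrable_bound)
    with sm' show ?thesis by (simp add: L2_H1_def)
  qed
  moreover have "l2_inner (leray (w t)) (\<psi> t)
          + (LINT s:{0..t}|lebesgue.
               l2_inner (convect (leray (w s)) (leray (w s))) (\<psi> s)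
               + l2_inner (weak_grad (leray (w s))) (grad (\<psi> s)))
        = l2_inner (leray w0) (\<psi> 0)
          + (LINT s:{0..t}|lebesgue. l2_inner (leray (w s)) (time_deriv T \<psi> s))"
    if \<psi>: "test_field T \<psi>" and div: "\<forall>t\<in>{0..<T}. \<forall>x. divergence (\<psi> t) x = 0" and t: "t \<in> {0..<T}" for \<psi> t
  proof -
    have sm: "smooth_torus (\<psi> s)" if "s \<in> {0..<T}" for s by (rule test_field_smooth[OF \<psi> that])
    have \<psi>\<sigma>: "\<psi> s \<in> L2_sigma" if "s \<in> {0..<T}" for s
      using div that by (intro divergence_free_L2_sigma sm) auto
    have d\<psi>: "time_deriv T \<psi> s \<in> L2_sigma" if "s \<in> {0..<T}" for s
      using div that by (intro time_deriv_L2_sigma \<psi>) auto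
    have "AE s in lebesgue. s \<in> {0<..<T} \<longrightarrow> w s \<in> H1"
      using AEH1 by (subst (asm) AE_restrict_space_iff) auto
    \<comment> \<open>The regularity of w is known on the open interval only, while the time
      integrals start at 0.\<close>
    moreover have "AE s in lebesgue. s \<noteq> (0::real)"
      using AE_not_in[of "{0::real}" lebesgue] by (simp add: negligible_iff_null_sets[symmetric])
    ultimately have "AE s in lebesgue. s \<in> {0..t} \<longrightarrow>
        l2_inner (convect (leray (w s)) (leray (w s))) (\<psi> s) + l2_inner (weak_grad (leray (w s))) (grad (\<psi> s))
        = l2_inner (\<lambda>x. convect (leray (w s)) (w s) x + grad_transp (leray (w s)) (w s) x) (\<psi> s)
          + l2_inner (weak_grad (w s)) (grad (\<psi> s))"
    proof eventually_elim
      case (elim s)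
      show ?case
      proof
        assume "s \<in> {0..t}"
        then have s: "s \<in> {0..<T}" and "w s \<in> H1" using t elim by auto
        then show "l2_inner (convect (leray (w s)) (leray (w s))) (\<psi> s) + l2_inner (weak_grad (leray (w s))) (grad (\<psi> s))
          = l2_inner (\<lambda>x. convect (leray (w s)) (w s) x + grad_transp (leray (w s)) (w s) x) (\<psi> s)
            + l2_inner (weak_grad (w s)) (grad (\<psi> s))"
          using nonlinear_term_leray[OF _ sm[OF s]] viscous_term_leray[OF _ sm[OF s]] div by simp
      qed
    qed
    note nonlinear = set_integral_cong_AE_lebesgue[OF this]
    \<comment> \<open>Unlike the nonlinear and viscous terms, this pairing agrees at every s, since
      \<open>w s\<close> is in L^2 throughout [0,T).\<close>
    have "(LINT s:{0..t}|lebesgue. l2_inner (leray (w s)) (time_deriv T \<psi> s))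
        = (LINT s:{0..t}|lebesgue. l2_inner (w s) (time_deriv T \<psi> s))"
      using t by (intro set_integral_cong_AE_lebesgue AE_I2) (auto intro!: leray_inner wL2 d\<psi>)
    moreover have "l2_inner (leray (w t)) (\<psi> t) = l2_inner (w t) (\<psi> t)"
      by (intro leray_inner wL2 \<psi>\<sigma> t)
    moreover have "l2_inner (leray w0) (\<psi> 0) = l2_inner w0 (\<psi> 0)"
      using \<open>T > 0\<close> by (intro leray_inner w0 \<psi>\<sigma>) auto
    ultimately show ?thesis using eq[OF \<psi> t] nonlinear by simp
  qed
  ultimately show ?thesis
    unfolding weak_solution_NS_def using w0 wL2 by (auto intro: leray_L2 leray_L2_sigma)
qed

end
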